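(* Let $\mathcal R=\{(r_m,\rho_m)\}_{m\ge1}\in\mathcal{MP}^{\mathbb N}$ and let $\mathcal F_{\mathcal R,*}=\mathcal F_{\mathcal R}\cap C(K_* )$. Then $\mathcal F_{\mathcal R,*}$ consists of constants if and only if $\sum_{m=1}^\infty\rho_m=\infty$. Furthermore, if $\sum_{m=1}^\infty\rho_m<\infty$, then $\mathcal F^*\subseteq\mathcal F_{\mathcal R,*}$ and $$\mathcal E_{\mathcal R}(u,u)=\mathcal E^\Sigma_{\mathcal R}(u,u)=C_*\,\mathcal E^*(u,u)$$ for any $u\in\mathcal F^*$, where $C_*=\prod_{m=1}^\infty(1-\rho_m)^{-1}$.
   Context: **Geometry.** Let $S=\{1,2,3\}$, $B=\{(1,2),(2,3),(3,1)\}$, and let $p_1,p_2,p_3\in\mathbb{R}^2$ be the vertices of a regular triangle with side length $1$ and $p_1+p_2+p_3=0$. Fix $\alpha\in(0,1)$. Put $G_i(x)=\frac{1-\alpha}{2}(x-p_i)+p_i$, $p_{ij}=G_i(p_j)$ for $i\ne j$, and let $e_{ij}$ be the line segment from $p_{ij}$ to $p_{ji}$. Let $W_0=\{\emptyset\}$, $W_m=S^m$, $W_*=\bigcup_{m\ge0}W_m$; $G_w=G_{w_1}\circ\cdots\circ G_{w_m}$, $G_\emptyset=\mathrm{id}$, $e^w_{ij}=G_w(e_{ij})$. The stretched Sierpinski gasket $K$ is the unique compact set with $K=\bigcup_{i\in S}G_i(K)\cup e_{12}\cup e_{23}\cup e_{31}$, and $\Sigma$ is the unique nonempty compact set with $\Sigma=\bigcup_iG_i(\Sigma)$;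 $K=\Sigma\cup\bigcup_{(w,(i,j))\in W_*\times B}e^w_{ij}$. $\Sigma$ is identified with $S^{\mathbb N}$ via $\omega_1\omega_2\ldots\mapsto\bigcap_mG_{\omega_1\dots\omega_m}(\Sigma)$. **Sierpinski gasket.** Let $F_i(x)=\frac12(x-p_i)+p_i$, $F_w=F_{w_1}\circ\cdots\circ F_{w_m}$, and $K_*$ the nonempty compact set with $K_*=\bigcup_iF_i(K_* )$. Let $\pi:\Sigma\to K_*$, $\{\pi(\omega_1\omega_2\ldots)\}=\bigcap_mF_{\omega_1\dots\omega_m}(K_* )$, and let $\pi_*:K\to K_*$ equal $\pi$ on $\Sigma$ and the constant $\pi(wijjj\ldots)=\pi(wjiii\ldots)$ on $e^w_{ij}$. $C(K_* )$ is regarded as a subset of $C(K)$ by identifying $u$ with $u\circ\pi_*$. Let $Q_0(u,u)=\sum_{(i,j)\in B}(u(p_i)-u(p_j))^2$. $\mathcal F^*$ is the set of $u\in C(K_* )$ for which the (non-decreasing) sequence $(5/3)^m\sum_{w\in W_m}Q_0(u\circ F_w,u\circ F_w)$ is bounded; via the identification $\mathcal F^*\subseteq C(K)$. **Forms.** For a segment $pq$ with $\xi_{p,q}(t)=(1-t)p+tq$, $H^1(pq)=\{u\mid u\circ\xi_{p,q}\in H^1([0,1])\}$ and $\mathcal D_{pq}(u,v)=\int_0^1(u\circ\xi_{p,q})'(v\circ\xi_{p,q})'dx$. $\widetilde{\mathcal F}=\{u\in C(K)\mid u|_{e^w_{ij}}\in H^1(e^w_{ij})\ \forall(w,(i,j))\in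 W_*\times B\}$; $\mathcal D^I_m(u,v)=\sum_{(w,(i,j))\in W_{m-1}\times B}\mathcal D_{e^w_{ij}}(u,v)$ for $m\ge1$; $Q^\Sigma_m(u,u)=\sum_{w\in W_m}Q_0(u\circ G_w,u\circ G_w)$. For $u\in C(K)$ such that $(5/3)^mQ^\Sigma_m(u,u)$ converges, $\mathcal E^*(u,u)=\lim_m(5/3)^mQ_m^\Sigma(u,u)$. **Matching pairs.** $\mathcal{MP}=\{(r,\rho)\in(0,\infty)^2\mid\frac53r+\rho=1\}$, and $\mathcal{MP}^{\mathbb N}$ is the set of sequences in $\mathcal{MP}$. For $\mathcal R=\{(r_m,\rho_m)\}_{m\ge1}\in\mathcal{MP}^{\mathbb N}$ put $\delta_0=1$, $\delta_m=r_1\cdots r_m$, $\gamma_m=\delta_{m-1}\rho_m$ ($m\ge1$), and $\mathcal E_{\mathcal R,m}(u,v)=\frac1{\delta_m}Q^\Sigma_m(u,v)+\sum_{k=1}^m\frac1{\gamma_k}\mathcal D^I_k(u,v)$ for $u,v\in\widetilde{\mathcal F}$. The sequence $\mathcal E_{\mathcal R,m}(u,u)$ is non-decreasing in $m$; $\mathcal F_{\mathcal R}=\{u\in\widetilde{\mathcal F}\mid\lim_m\mathcal E_{\mathcal R,m}(u,u)<\infty\}$, $\mathcal E_{\mathcal R}(u,v)=\lim_m\mathcal E_{\mathcal R,m}(u,v)$ on $\mathcal F_{\mathcal R}$. For $u\in\mathcal F_{\mathcal R}$, $\mathcal E^I_{\mathcal R}(u,u)=\sum_{k\ge1}\frac1{\gamma_k}\mathcal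 D^I_k(u,u)$ (line part) and $\mathcal E^\Sigma_{\mathcal R}(u,u)=\mathcal E_{\mathcal R}(u,u)-\mathcal E^I_{\mathcal R}(u,u)=\lim_m\frac1{\delta_m}Q^\Sigma_m(u,u)$ (SG part). *)

theory Defs
  imports "HOL-Analysis.Analysis"
begin

section \<open>Words and iterated function systems\<close>

definition S :: "nat set" where
  "S = {1, 2, 3}"

definition B :: "(nat \<times> nat) set" where
  "B = {(1, 2), (2, 3), (3, 1)}"

definition W :: "nat \<Rightarrow> nat list set" where
  "W m = {w. set w \<subseteq> S \<and> length w = m}"

definition W_star :: "nat list set" where
  "W_star = (\<Union>m. W m)"

definition comp_word :: "(nat \<Rightarrow> 'a \<Rightarrow> 'a) \<Rightarrow> nat list \<Rightarrow> 'a \<Rightarrow> 'a" where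
  "comp_word f w = foldr (\<circ>) (map f w) id"

text \<open>Infinite words are functions \<^term>\<open>\<omega> :: nat \<Rightarrow> nat\<close>, the first letter having index 0.\<close>

definition infinite_words :: "(nat \<Rightarrow> nat) set" where
  "infinite_words = {\<omega>. \<forall>n. \<omega> n \<in> S}"

definition cylinders :: "(nat \<Rightarrow> 'a \<Rightarrow> 'a) \<Rightarrow> 'a set \<Rightarrow> (nat \<Rightarrow> nat) \<Rightarrow> 'a set" where
  "cylinders f A \<omega> = (\<Inter>m. comp_word f (map \<omega> [0..<m]) ` A)"

text \<open>The infinite word \<open>w i j j j \<dots>\<close>.\<close>

definition edge_word :: "nat list \<Rightarrow> nat \<Rightarrow> nat \<Rightarrow> nat \<Rightarrow> nat" where
  "edge_word w i j n = (if n < length w then w ! n else if n = length w then i else j)"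


section \<open>Geometry\<close>

definition regular_triangle :: "(nat \<Rightarrow> real^2) \<Rightarrow> bool" where
  "regular_triangle p \<longleftrightarrow>
     (\<forall>i\<in>S. \<forall>j\<in>S. i \<noteq> j \<longrightarrow> dist (p i) (p j) = 1) \<and> p 1 + p 2 + p 3 = 0"

definition G :: "(nat \<Rightarrow> real^2) \<Rightarrow> real \<Rightarrow> nat \<Rightarrow> real^2 \<Rightarrow> real^2" where
  "G p \<alpha> i x = ((1 - \<alpha>) / 2) *\<^sub>R (x - p i) + p i"

definition F :: "(nat \<Rightarrow> real^2) \<Rightarrow> nat \<Rightarrow> real^2 \<Rightarrow> real^2" where
  "F p i x = (1 / 2) *\<^sub>R (x - p i) + p i"

definition edge :: "(nat \<Rightarrow> real^2) \<Rightarrow> real \<Rightarrow> nat list \<Rightarrow> nat \<Rightarrow> nat \<Rightarrow> (real^2) set" where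
  "edge p \<alpha> w i j = comp_word (G p \<alpha>) w ` closed_segment (G p \<alpha> i (p j)) (G p \<alpha> j (p i))"

definition K :: "(nat \<Rightarrow> real^2) \<Rightarrow> real \<Rightarrow> (real^2) set" where
  "K p \<alpha> = (THE X. compact X \<and>
     X = (\<Union>i\<in>S. G p \<alpha> i ` X) \<union> (\<Union>(i, j)\<in>B. edge p \<alpha> [] i j))"

definition Sigma_set :: "(nat \<Rightarrow> real^2) \<Rightarrow> real \<Rightarrow> (real^2) set" where
  "Sigma_set p \<alpha> = (THE X. compact X \<and> X \<noteq> {} \<and> X = (\<Union>i\<in>S. G p \<alpha> i ` X))"

definition K_star :: "(nat \<Rightarrow> real^2) \<Rightarrow> (real^2) set" where
  "K_star p = (THE X. compact X \<and> X \<noteq> {} \<and> X = (\<Union>i\<in>S. F p i ` X))"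

definition address :: "(nat \<Rightarrow> real^2) \<Rightarrow> real \<Rightarrow> real^2 \<Rightarrow> nat \<Rightarrow> nat" where
  "address p \<alpha> x =
     (THE \<omega>. \<omega> \<in> infinite_words \<and> cylinders (G p \<alpha>) (Sigma_set p \<alpha>) \<omega> = {x})"

definition pi_word :: "(nat \<Rightarrow> real^2) \<Rightarrow> (nat \<Rightarrow> nat) \<Rightarrow> real^2" where
  "pi_word p \<omega> = (THE y. cylinders (F p) (K_star p) \<omega> = {y})"

definition pi_star :: "(nat \<Rightarrow> real^2) \<Rightarrow> real \<Rightarrow> real^2 \<Rightarrow> real^2" where
  "pi_star p \<alpha> x =
     (if x \<in> Sigma_set p \<alpha> then pi_word p (address p \<alpha> x)
      else THE y. \<exists>w\<in>W_star. \<exists>(i, j)\<in>B. x \<in> edge p \<alpha> w i j \<and> y = pi_word p (edge_word w i j))"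

text \<open>
  A function on a set \<open>X\<close> is represented by a total function whose values outside \<open>X\<close> are
  irrelevant. Accordingly, the image in \<open>C(K)\<close> of a set \<open>A\<close> of functions on \<open>K\<^sub>*\<close> under the
  identification of \<open>v\<close> with \<open>v \<circ> \<pi>\<^sub>*\<close> consists of all \<open>u\<close> agreeing on \<open>K\<close> with such a function.
\<close>

definition embed_K :: "(nat \<Rightarrow> real^2) \<Rightarrow> real \<Rightarrow> (real^2 \<Rightarrow> real) set \<Rightarrow> (real^2 \<Rightarrow> real) set" where
  "embed_K p \<alpha> A = {u. \<exists>v\<in>A. \<forall>x\<in>K p \<alpha>. u x = v (pi_star p \<alpha> x)}"

definition C_K :: "(nat \<Rightarrow> real^2) \<Rightarrow> real \<Rightarrow> (real^2 \<Rightarrow> real) set" where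
  "C_K p \<alpha> = {u. continuous_on (K p \<alpha>) u}"

definition C_K_star :: "(nat \<Rightarrow> real^2) \<Rightarrow> (real^2 \<Rightarrow> real) set" where
  "C_K_star p = {v. continuous_on (K_star p) v}"


section \<open>The Sobolev space \<open>H\<^sup>1([0,1])\<close>\<close>

definition L2_unit :: "(real \<Rightarrow> real) set" where
  "L2_unit = {f. f \<in> borel_measurable (lebesgue_on {0..1}) \<and>
                 integrable (lebesgue_on {0..1}) (\<lambda>x. (f x)\<^sup>2)}"

text \<open>\<open>C\<^sub>c\<^sup>\<infinity>((0,1))\<close>, each function being extended by 0 to the real line.\<close>

definition test_functions :: "(real \<Rightarrow> real) set" where
  "test_functions = {\<phi>. (\<forall>n x. (deriv ^^ n) \<phi> differentiable (at x)) \<and>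
                         closure {x. \<phi> x \<noteq> 0} \<subseteq> {0<..<1}}"

definition is_weak_deriv :: "(real \<Rightarrow> real) \<Rightarrow> (real \<Rightarrow> real) \<Rightarrow> bool" where
  "is_weak_deriv f g \<longleftrightarrow> g \<in> L2_unit \<and>
     (\<forall>\<phi>\<in>test_functions. integral\<^sup>L (lebesgue_on {0..1}) (\<lambda>x. f x * deriv \<phi> x) =
                         - integral\<^sup>L (lebesgue_on {0..1}) (\<lambda>x. g x * \<phi> x))"

definition H1_unit :: "(real \<Rightarrow> real) set" where
  "H1_unit = {f \<in> L2_unit. \<exists>g. is_weak_deriv f g}"

text \<open>Weak derivatives are unique almost everywhere, so the choice does not affect integrals.\<close>

definition weak_deriv :: "(real \<Rightarrow> real) \<Rightarrow> real \<Rightarrow> real" where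
  "weak_deriv f = (SOME g. is_weak_deriv f g)"

definition xi :: "real^2 \<Rightarrow> real^2 \<Rightarrow> real \<Rightarrow> real^2" where
  "xi a b t = (1 - t) *\<^sub>R a + t *\<^sub>R b"

definition H1_seg :: "real^2 \<Rightarrow> real^2 \<Rightarrow> (real^2 \<Rightarrow> real) set" where
  "H1_seg a b = {u. u \<circ> xi a b \<in> H1_unit}"

definition D_seg :: "real^2 \<Rightarrow> real^2 \<Rightarrow> (real^2 \<Rightarrow> real) \<Rightarrow> (real^2 \<Rightarrow> real) \<Rightarrow> real" where
  "D_seg a b u v = integral\<^sup>L (lebesgue_on {0..1})
     (\<lambda>x. weak_deriv (u \<circ> xi a b) x * weak_deriv (v \<circ> xi a b) x)"


section \<open>Forms\<close>

text \<open>The segment \<open>e\<^sup>w\<^sub>i\<^sub>j\<close> is parametrised by \<^const>\<open>xi\<close> from \<open>G\<^sub>w(p\<^sub>i\<^sub>j)\<close> to \<open>G\<^sub>w(p\<^sub>j\<^sub>i)\<close>.\<close>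

definition edge_end :: "(nat \<Rightarrow> real^2) \<Rightarrow> real \<Rightarrow> nat list \<Rightarrow> nat \<Rightarrow> nat \<Rightarrow> real^2" where
  "edge_end p \<alpha> w i j = comp_word (G p \<alpha>) w (G p \<alpha> i (p j))"

definition F_tilde :: "(nat \<Rightarrow> real^2) \<Rightarrow> real \<Rightarrow> (real^2 \<Rightarrow> real) set" where
  "F_tilde p \<alpha> = {u \<in> C_K p \<alpha>.
     \<forall>w\<in>W_star. \<forall>(i, j)\<in>B. u \<in> H1_seg (edge_end p \<alpha> w i j) (edge_end p \<alpha> w j i)}"

definition Q0 :: "(nat \<Rightarrow> real^2) \<Rightarrow> (real^2 \<Rightarrow> real) \<Rightarrow> (real^2 \<Rightarrow> real) \<Rightarrow> real" where
  "Q0 p u v = (\<Sum>(i, j)\<in>B. (u (p i) - u (p j)) * (v (p i) - v (p j)))"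

definition F_star :: "(nat \<Rightarrow> real^2) \<Rightarrow> (real^2 \<Rightarrow> real) set" where
  "F_star p = {v \<in> C_K_star p. bounded (range (\<lambda>m.
     (5/3)^m * (\<Sum>w\<in>W m. Q0 p (v \<circ> comp_word (F p) w) (v \<circ> comp_word (F p) w))))}"

definition Q_Sigma ::
  "(nat \<Rightarrow> real^2) \<Rightarrow> real \<Rightarrow> nat \<Rightarrow> (real^2 \<Rightarrow> real) \<Rightarrow> (real^2 \<Rightarrow> real) \<Rightarrow> real" where
  "Q_Sigma p \<alpha> m u v =
     (\<Sum>w\<in>W m. Q0 p (u \<circ> comp_word (G p \<alpha>) w) (v \<circ> comp_word (G p \<alpha>) w))"

definition D_I ::
  "(nat \<Rightarrow> real^2) \<Rightarrow> real \<Rightarrow> nat \<Rightarrow> (real^2 \<Rightarrow> real) \<Rightarrow> (real^2 \<Rightarrow> real) \<Rightarrow> real" where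
  "D_I p \<alpha> m u v =
     (\<Sum>(w, i, j)\<in>W (m - 1) \<times> B. D_seg (edge_end p \<alpha> w i j) (edge_end p \<alpha> w j i) u v)"

definition E_star :: "(nat \<Rightarrow> real^2) \<Rightarrow> real \<Rightarrow> (real^2 \<Rightarrow> real) \<Rightarrow> real" where
  "E_star p \<alpha> u = lim (\<lambda>m. (5/3)^m * Q_Sigma p \<alpha> m u u)"


section \<open>Matching pairs and the resistance forms\<close>

definition MP :: "(real \<times> real) set" where
  "MP = {(r, \<rho>). 0 < r \<and> 0 < \<rho> \<and> 5/3 * r + \<rho> = 1}"

text \<open>Sequences of matching pairs are indexed from 1; the value at index 0 is never used.\<close>

definition MP_seq :: "(nat \<Rightarrow> real \<times> real) set" where
  "MP_seq = {R. \<forall>m\<ge>1. R m \<in> MP}"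

definition delta :: "(nat \<Rightarrow> real \<times> real) \<Rightarrow> nat \<Rightarrow> real" where
  "delta R m = (\<Prod>k=1..m. fst (R k))"

definition gamma :: "(nat \<Rightarrow> real \<times> real) \<Rightarrow> nat \<Rightarrow> real" where
  "gamma R m = delta R (m - 1) * snd (R m)"

definition E_Rm :: "(nat \<Rightarrow> real^2) \<Rightarrow> real \<Rightarrow> (nat \<Rightarrow> real \<times> real) \<Rightarrow> nat \<Rightarrow>
    (real^2 \<Rightarrow> real) \<Rightarrow> (real^2 \<Rightarrow> real) \<Rightarrow> real" where
  "E_Rm p \<alpha> R m u v =
     1 / delta R m * Q_Sigma p \<alpha> m u v + (\<Sum>k=1..m. 1 / gamma R k * D_I p \<alpha> k u v)"

text \<open>The sequence \<open>E_Rm p \<alpha> R m u u\<close> is non-decreasing in \<open>m\<close>, so its limit is finite iff it converges.\<close>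

definition F_R :: "(nat \<Rightarrow> real^2) \<Rightarrow> real \<Rightarrow> (nat \<Rightarrow> real \<times> real) \<Rightarrow> (real^2 \<Rightarrow> real) set" where
  "F_R p \<alpha> R = {u \<in> F_tilde p \<alpha>. convergent (\<lambda>m. E_Rm p \<alpha> R m u u)}"

definition E_R :: "(nat \<Rightarrow> real^2) \<Rightarrow> real \<Rightarrow> (nat \<Rightarrow> real \<times> real) \<Rightarrow>
    (real^2 \<Rightarrow> real) \<Rightarrow> (real^2 \<Rightarrow> real) \<Rightarrow> real" where
  "E_R p \<alpha> R u v = lim (\<lambda>m. E_Rm p \<alpha> R m u v)"

definition E_R_line ::
  "(nat \<Rightarrow> real^2) \<Rightarrow> real \<Rightarrow> (nat \<Rightarrow> real \<times> real) \<Rightarrow> (real^2 \<Rightarrow> real) \<Rightarrow> real" where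
  "E_R_line p \<alpha> R u = (\<Sum>k. 1 / gamma R (Suc k) * D_I p \<alpha> (Suc k) u u)"

definition E_R_SG ::
  "(nat \<Rightarrow> real^2) \<Rightarrow> real \<Rightarrow> (nat \<Rightarrow> real \<times> real) \<Rightarrow> (real^2 \<Rightarrow> real) \<Rightarrow> real" where
  "E_R_SG p \<alpha> R u = E_R p \<alpha> R u u - E_R_line p \<alpha> R u"

definition F_R_star ::
  "(nat \<Rightarrow> real^2) \<Rightarrow> real \<Rightarrow> (nat \<Rightarrow> real \<times> real) \<Rightarrow> (real^2 \<Rightarrow> real) set" where
  "F_R_star p \<alpha> R = F_R p \<alpha> R \<inter> embed_K p \<alpha> (C_K_star p)"

definition C_star :: "(nat \<Rightarrow> real \<times> real) \<Rightarrow> real" where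
  "C_star R = (\<Prod>m. inverse (1 - snd (R (Suc m))))"

end

(*
  A function constant on all line segments has no line part, so for u = v o pi_star the form E_Rm is
  the level m energy of v on the Sierpinski gasket, (5/3)^m sum_w Q0(v o F_w), divided by
  (1 - rho_1) ... (1 - rho_m). The former is non-decreasing in m by the harmonic extension identity,
  and the latter product tends to 0 exactly if sum rho_m diverges; hence divergence forces all level
  energies of v to vanish, while convergence gives the factor C_star. A nonconstant function of
  finite energy is a coordinate of the harmonic map of the gasket. Both the continuity of pi_star and
  the existence of the harmonic map follow from one principle: a map g with g o G_i = f_i o g has as
  its graph the attractor of the product maps (G_i, f_i), so one only needs that this attractor is
  single valued. That the weak derivative of a constant vanishes almost everywhere is the fundamental
  lemma of the calculus of variations.
*)

theory Submission
  imports Defs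
begin

section \<open>Weak derivatives of constants\<close>

text \<open>\<open>pi_star\<close> is a definite description over addresses and segments, so neither
  its continuity nor its compatibility with the maps can be read off from it. The way around is to
  build a map with these properties from its graph and to identify \<open>pi_star\<close> with it
  afterwards. The construction has to serve two domains: \<open>K\<close>, whose cells are disjoint
  and linked by segments, and \<open>K_star\<close>, whose cells touch. Hence the parameter \<beta>,
  which is \<alpha> or 0; for \<beta> = 0 the segments shrink to the touching points. In both cases
  single valuedness rests on \<open>f i (q j) = f j (q i)\<close>: this is the value on the whole
  segment, or at the touching point. The product of the factors 1 - \<rho> arises because matching
  means r = 3/5 (1 - \<rho>); the reciprocal of \<delta> at level m thus supplies exactly the
  renormalising factor (5/3)^m. Weak derivatives are picked by choice, so even for a constant
  function the one that occurs is known only up to null sets.\<close>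

lemma exp_inverse_bound:
  fixes s t :: real
  assumes "0 < s" "0 < t"
  shows "exp (- s / t) / t ^ n \<le> fact (n + 2) / s ^ (n + 2) * t\<^sup>2"
proof -
  \<comment> \<open>A single term of the exponential series, two orders beyond \<open>n\<close>: the
    surplus factor \<open>t\<^sup>2\<close> is what makes difference quotients of
    \<open>bump\<close> vanish at zeros of \<open>q\<close>.\<close>
  have "(s / t) ^ (n + 2) / fact (n + 2) \<le> exp (s / t)"
  proof -
    have "(\<Sum>k\<in>{n+2}. (s / t) ^ k /\<^sub>R fact k) \<le> exp (s / t)"
      unfolding exp_def by (rule sum_le_suminf[OF summable_exp_generic]) (use assms in auto)
    then show ?thesis by (simp add: divide_simps mult.commute)
  qed
  then have "s ^ (n + 2) \<le> exp (s / t) * (fact (n + 2) * t ^ (n + 2))"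
    using assms by (simp add: power_divide divide_simps mult_ac)
  then have "s ^ (n + 2) * exp (- s / t) \<le> fact (n + 2) * t ^ (n + 2)"
    using assms by (simp add: exp_minus divide_simps mult_ac)
  then show ?thesis
    using assms by (simp add: divide_simps mult_ac power_add power2_eq_square)
qed

text \<open>This class is closed under differentiation, with \<open>q\<close> and \<open>s\<close>
  fixed, so smoothness needs only one derivative formula. The parameter \<open>s\<close> stays free
  because letting it tend to 0 turns the case \<open>P = 1\<close>, \<open>n = 0\<close> into the
  indicator of the set where \<open>q\<close> is positive.\<close>

definition bump :: "real poly \<Rightarrow> real \<Rightarrow> real poly \<Rightarrow> nat \<Rightarrow> real \<Rightarrow> real" where
  "bump q s P n x = (if 0 < poly q x then poly P x / poly q x ^ n * exp (- s / poly q x) else 0)"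

lemma abs_bump_le:
  assumes "0 < s"
  shows "\<bar>bump q s P n x\<bar> \<le> fact (n + 2) / s ^ (n + 2) * \<bar>poly P x\<bar> * (poly q x)\<^sup>2"
proof (cases "0 < poly q x")
  case True
  have "\<bar>poly P x\<bar> * (exp (- s / poly q x) / poly q x ^ n)
      \<le> \<bar>poly P x\<bar> * (fact (n + 2) / s ^ (n + 2) * (poly q x)\<^sup>2)"
    by (rule mult_left_mono[OF exp_inverse_bound]) (use assms True in auto)
  then show ?thesis
    using True by (simp add: bump_def abs_mult mult_ac)
qed (use assms in \<open>simp add: bump_def\<close>)

text \<open>Where \<open>q\<close> is positive this is the quotient rule over the denominator
  \<open>q ^ (n + 2)\<close>; where it is negative the function is locally 0. At a zero of
  \<open>q\<close> the derivative is 0 by the flatness of the exponential.\<close>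

lemma bump_has_field_derivative:
  assumes s: "0 < s"
  shows "(bump q s P n has_field_derivative
    bump q s (pderiv P * q\<^sup>2 - smult (of_nat n) (P * pderiv q * q) + smult s (P * pderiv q)) (n + 2) x) (at x)"
    (is "(_ has_field_derivative bump q s ?P' _ x) _")
proof -
  consider "0 < poly q x" | "poly q x < 0" | "poly q x = 0" by linarith
  then show ?thesis
  proof cases
    case 1
    have "((\<lambda>x. poly P x / poly q x ^ n * exp (- s / poly q x)) has_field_derivative
        poly ?P' x / poly q x ^ (n + 2) * exp (- s / poly q x)) (at x)"
    proof -
      define u du v dv e where "u = poly q x" and "du = poly (pderiv q) x"
        and "v = poly P x" and "dv = poly (pderiv P) x" and "e = exp (- s / u)"
      have u: "0 < u" using 1 by (simp add: u_def)
      have "((\<lambda>x. poly P x / poly q x ^ n * exp (- s / poly q x)) has_field_derivative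
          (dv * u ^ n - v * (real n * u ^ (n - 1) * du)) / (u ^ n * u ^ n) * e
            + e * (s * du / (u * u)) * (v / u ^ n)) (at x)"
        unfolding u_def du_def v_def dv_def e_def
        by (rule DERIV_mult DERIV_divide DERIV_power poly_DERIV DERIV_exp derivative_eq_intros refl
            | use 1 in \<open>simp add: mult_ac\<close>)+
      moreover have "(dv * u ^ n - v * (real n * u ^ (n - 1) * du)) / (u ^ n * u ^ n) * e
            + e * (s * du / (u * u)) * (v / u ^ n)
          = (dv * u\<^sup>2 - real n * (v * du * u) + s * (v * du)) / u ^ (n + 2) * e"
        using u by (cases n) (simp_all add: field_simps power2_eq_square)
      ultimately show ?thesis
        by (simp add: u_def du_def v_def dv_def e_def)
    qed
    then have "(bump q s P n has_field_derivative
        poly ?P' x / poly q x ^ (n + 2) * exp (- s / poly q x)) (at x)"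
      by (rule has_field_derivative_transform_within_open[where S = "{x. 0 < poly q x}"])
         (use 1 in \<open>auto simp: bump_def intro!: open_Collect_less continuous_intros\<close>)
    then show ?thesis using 1 by (simp add: bump_def)
  next
    case 2
    have "((\<lambda>x. 0) has_field_derivative 0) (at x)" by simp
    then have "(bump q s P n has_field_derivative 0) (at x)"
      by (rule has_field_derivative_transform_within_open[where S = "{x. poly q x < 0}"])
         (use 2 in \<open>auto simp: bump_def intro!: open_Collect_less continuous_intros\<close>)
    then show ?thesis using 2 by (simp add: bump_def)
  next
    case 3
    \<comment> \<open>Splitting off the linear factor makes the bound on \<open>bump\<close>
      quadratic in \<open>y - x\<close>, so the difference quotient is bounded by a continuous
      multiple of \<open>\<bar>y - x\<bar>\<close>.\<close>
    then obtain r where r: "q = [:- x, 1:] * r"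
      unfolding poly_eq_0_iff_dvd dvd_def by blast
    define C where "C = fact (n + 2) / s ^ (n + 2)"
    have "((\<lambda>y. (bump q s P n y - bump q s P n x) / (y - x)) \<longlongrightarrow> 0) (at x)"
    proof (rule Lim_null_comparison)
      show "eventually (\<lambda>y. norm ((bump q s P n y - bump q s P n x) / (y - x))
          \<le> C * \<bar>poly P y\<bar> * (poly r y)\<^sup>2 * \<bar>y - x\<bar>) (at x)"
      proof (rule always_eventually, rule allI)
        fix y
        have "\<bar>bump q s P n y\<bar> \<le> C * \<bar>poly P y\<bar> * (poly q y)\<^sup>2"
          unfolding C_def by (rule abs_bump_le[OF s])
        also have "\<dots> = C * \<bar>poly P y\<bar> * (poly r y)\<^sup>2 * \<bar>y - x\<bar> * \<bar>y - x\<bar>"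
        proof -
          have "poly q y = (y - x) * poly r y" by (simp add: r algebra_simps)
          then have "(poly q y)\<^sup>2 = (poly r y)\<^sup>2 * (\<bar>y - x\<bar> * \<bar>y - x\<bar>)"
            by (simp add: power_mult_distrib power2_eq_square)
          then show ?thesis by simp
        qed
        finally show "norm ((bump q s P n y - bump q s P n x) / (y - x))
          \<le> C * \<bar>poly P y\<bar> * (poly r y)\<^sup>2 * \<bar>y - x\<bar>"
          using 3 by (cases "y = x") (simp_all add: bump_def divide_simps)
      qed
      show "((\<lambda>y. C * \<bar>poly P y\<bar> * (poly r y)\<^sup>2 * \<bar>y - x\<bar>) \<longlongrightarrow> 0) (at x)"
        by (auto intro!: tendsto_eq_intros)
    qed
    then show ?thesis using 3 by (simp add: has_field_derivative_iff bump_def)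
  qed
qed

lemma iterated_deriv_bump:
  assumes "0 < s"
  shows "\<exists>P'. (deriv ^^ m) (bump q s P n) = bump q s P' (n + 2 * m)"
proof (induction m)
  case 0
  then show ?case by auto
next
  case (Suc m)
  then obtain P' where P': "(deriv ^^ m) (bump q s P n) = bump q s P' (n + 2 * m)" by blast
  have "deriv (bump q s P' (n + 2 * m)) = bump q s (pderiv P' * q\<^sup>2
      - smult (of_nat (n + 2 * m)) (P' * pderiv q * q) + smult s (P' * pderiv q)) (n + 2 * m + 2)"
    by (rule ext, rule DERIV_imp_deriv, rule bump_has_field_derivative[OF assms])
  with P' show ?case by (auto simp: add_ac)
qed

lemma bump_in_test_functions:
  assumes "0 < s" "0 < a" "a < b" "b < 1"
  shows "bump ([:- a, 1:] * [:b, - 1:]) s P n \<in> test_functions"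
proof -
  define q where "q = [:- a, 1:] * [:b, - 1:]"
  have q: "poly q x = (x - a) * (b - x)" for x
    by (simp add: q_def algebra_simps)
  let ?f = "bump q s P n"
  have "(deriv ^^ m) ?f differentiable (at x)" for m x
    using iterated_deriv_bump[OF assms(1)] bump_has_field_derivative[OF assms(1)]
    by (metis real_differentiable_def)
  moreover have "closure {x. ?f x \<noteq> 0} \<subseteq> {a..b}"
    by (rule closure_minimal) (use assms in \<open>auto simp: bump_def q zero_less_mult_iff split: if_splits\<close>)
  ultimately show ?thesis
    using assms unfolding q_def[symmetric] by (force simp: test_functions_def)
qed

section \<open>The fundamental lemma of the calculus of variations\<close>

lemma test_function_cont:
  assumes "\<phi> \<in> test_functions"
  shows "continuous_on A \<phi>"
proof -
  have "\<phi> differentiable (at x)" for x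
    using assms by (auto simp: test_functions_def dest: spec[of _ 0])
  then show ?thesis
    by (auto intro!: continuous_at_imp_continuous_on differentiable_imp_continuous_within)
qed

lemma L2_unit_integrable:
  assumes "g \<in> L2_unit"
  shows "integrable (lebesgue_on {0..1}) g"
proof (rule Bochner_Integration.integrable_bound)
  show "integrable (lebesgue_on {0..1}) (\<lambda>x. 1 + (g x)\<^sup>2)"
    using assms by (auto simp: L2_unit_def integrable_on_const)
  have "\<bar>x\<bar> \<le> 1 + x\<^sup>2" for x :: real
    using sum_squares_bound[of 1 "\<bar>x\<bar>"] by (auto simp: power2_eq_square)
  then show "AE x in lebesgue_on {0..1}. norm (g x) \<le> norm (1 + (g x)\<^sup>2)"
    by auto
qed (use assms in \<open>auto simp: L2_unit_def\<close>)

text \<open>The bumps with \<open>q = (x - a) (b - x)\<close> and \<open>s = 1 / (k + 1)\<close> are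
  test functions bounded by 1 that tend pointwise to the indicator of the open interval; dominated
  convergence with majorant \<open>\<bar>g\<bar>\<close> passes orthogonality to the limit.\<close>

lemma orthogonal_test_functions_integral_0:
  assumes g: "g \<in> L2_unit"
    and orth: "\<And>\<phi>. \<phi> \<in> test_functions \<Longrightarrow> integral\<^sup>L (lebesgue_on {0..1}) (\<lambda>x. g x * \<phi> x) = 0"
    and ab: "0 < a" "a < b" "b < 1"
  shows "integral {a..b} g = 0"
proof -
  define q where "q = [:- a, 1:] * [:b, - 1:]"
  define \<phi> where "\<phi> k = bump q (1 / real (Suc k)) 1 0" for k
  have test: "\<phi> k \<in> test_functions" for k
    unfolding \<phi>_def q_def using ab by (intro bump_in_test_functions) auto
  have int: "integrable (lebesgue_on {0..1}) g" by (rule L2_unit_integrable[OF g])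
  have meas: "\<phi> k \<in> borel_measurable (lebesgue_on {0..1})" for k
    by (rule continuous_imp_measurable_on_sets_lebesgue[OF test_function_cont[OF test]]) auto
  have q: "poly q x = (x - a) * (b - x)" for x by (simp add: q_def algebra_simps)
  have pos: "0 < (x - a) * (b - x) \<longleftrightarrow> x \<in> {a<..<b}" for x
    using ab by (auto simp: zero_less_mult_iff)
  have sets: "{a<..<b} \<in> sets (lebesgue_on {0..1})"
    using ab by (auto simp: sets_restrict_space intro!: image_eqI[of _ _ "{a<..<b}"])
  have bound: "\<bar>\<phi> k x\<bar> \<le> 1" for k x
    unfolding \<phi>_def bump_def q by (auto simp: pos)
  have lim: "(\<lambda>k. \<phi> k x) \<longlonglongrightarrow> indicator {a<..<b} x" for x
  proof (cases "x \<in> {a<..<b}")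
    case True
    have "(\<lambda>k. exp (- (1 / real (Suc k)) / ((x - a) * (b - x)))) \<longlonglongrightarrow> exp (- 0 / ((x - a) * (b - x)))"
      by (intro tendsto_intros LIMSEQ_Suc[OF lim_1_over_n]) (use True in auto)
    then show ?thesis using True pos[of x] by (simp add: \<phi>_def bump_def q del: of_nat_Suc)
  next
    case False
    then have "\<phi> k x = 0" for k using pos[of x] by (simp add: \<phi>_def bump_def q)
    with False show ?thesis by simp
  qed
  have "(\<lambda>k. integral\<^sup>L (lebesgue_on {0..1}) (\<lambda>x. g x * \<phi> k x)) \<longlonglongrightarrow>
      integral\<^sup>L (lebesgue_on {0..1}) (\<lambda>x. g x * indicator {a<..<b} x)"
  proof (rule integral_dominated_convergence[where w = "\<lambda>x. \<bar>g x\<bar>"])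
    show "(\<lambda>x. g x * indicator {a<..<b} x) \<in> borel_measurable (lebesgue_on {0..1})"
      by (rule borel_measurable_times[OF borel_measurable_integrable[OF int]
            borel_measurable_indicator[OF sets]])
    show "(\<lambda>x. g x * \<phi> k x) \<in> borel_measurable (lebesgue_on {0..1})" for k
      by (rule borel_measurable_times[OF borel_measurable_integrable[OF int] meas])
    show "AE x in lebesgue_on {0..1}. (\<lambda>k. g x * \<phi> k x) \<longlonglongrightarrow> g x * indicator {a<..<b} x"
      using lim by (auto intro!: tendsto_intros)
    show "AE x in lebesgue_on {0..1}. norm (g x * \<phi> k x) \<le> \<bar>g x\<bar>" for k
      using bound[of k] by (auto simp: abs_mult intro!: mult_left_le)
  qed (use int in auto)
  then have "integral\<^sup>L (lebesgue_on {0..1}) (\<lambda>x. g x * indicator {a<..<b} x) = 0"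
    using orth[OF test] by (simp add: LIMSEQ_const_iff)
  moreover have "integrable (lebesgue_on {0..1}) (\<lambda>x. g x * indicator {a<..<b} x)"
    by (rule integrable_real_mult_indicator[OF sets int])
  ultimately have "integral {0..1} (\<lambda>x. g x * indicator {a<..<b} x) = 0"
    by (simp add: lebesgue_integral_eq_integral)
  also have "(\<lambda>x. g x * indicator {a<..<b} x) = (\<lambda>x. if x \<in> {a<..<b} then g x else 0)"
    by (auto simp: indicator_def)
  also have "integral {0..1} \<dots> = integral ({a<..<b} \<inter> {0..1}) g"
    by (simp only: integral_restrict_Int)
  also have "{a<..<b} \<inter> {0..1} = {a<..<b}"
    using ab by auto
  also have "integral {a<..<b} g = integral {a..b} g"
    using integral_open_interval_real by (metis interval_cbox box_real(1))
  finally show ?thesis .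
qed

text \<open>By Lebesgue differentiation, averages over short intervals to the right of
  \<open>x\<close> tend to \<open>g x\<close> for almost every \<open>x\<close>, and these averages
  vanish.\<close>

lemma orthogonal_test_functions_AE_0:
  assumes g: "g \<in> L2_unit"
    and orth: "\<And>\<phi>. \<phi> \<in> test_functions \<Longrightarrow> integral\<^sup>L (lebesgue_on {0..1}) (\<lambda>x. g x * \<phi> x) = 0"
  shows "AE x in lebesgue_on {0..1}. g x = 0"
proof -
  \<comment> \<open>The differentiation theorem asks for integrability on every box, hence the
    extension by 0.\<close>
  define h where "h x = (if x \<in> {0..1} then g x else 0)" for x
  have "g integrable_on {0..1}"
    by (rule integrable_on_lebesgue_on[OF L2_unit_integrable[OF g]]) auto
  then have "h integrable_on UNIV"
    unfolding h_def using integrable_restrict_UNIV by blast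
  then have "h integrable_on cbox a b" for a b
    by (rule integrable_on_subcbox) auto
  then obtain N where N: "negligible N"
    "\<And>x e. \<lbrakk>x \<notin> N; 0 < e\<rbrakk> \<Longrightarrow> \<exists>d>0. \<forall>t. 0 < t \<and> t < d \<longrightarrow>
       norm (integral (cbox x (x + t *\<^sub>R One)) h /\<^sub>R t ^ DIM(real) - h x) < e"
    using integrable_ccontinuous_explicit by blast
  have "g x = 0" if x: "x \<in> {0<..<1}" "x \<notin> N" for x
  proof (rule ccontr)
    assume "g x \<noteq> 0"
    then obtain d where d: "d > 0" "\<And>t. 0 < t \<and> t < d \<Longrightarrow>
       norm (integral (cbox x (x + t *\<^sub>R One)) h /\<^sub>R t ^ DIM(real) - h x) < \<bar>g x\<bar>"
      using N(2)[of x "\<bar>g x\<bar>"] x by auto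
    \<comment> \<open>Besides being short, the interval must end before 1: vanishing integrals are
      known only for intervals compactly inside (0,1).\<close>
    obtain t where t: "0 < t" "t < d" "x + t < 1"
    proof
      show "0 < min d (1 - x) / 2" "min d (1 - x) / 2 < d" "x + min d (1 - x) / 2 < 1"
        using d x by (auto simp: min_def field_simps)
    qed
    have "integral {x..x+t} h = integral {x..x+t} g"
      by (rule integral_cong) (use x t in \<open>auto simp: h_def\<close>)
    also have "\<dots> = 0"
      by (rule orthogonal_test_functions_integral_0[OF g orth]) (use x t in auto)
    finally show False using d(2)[of t] t x by (auto simp: h_def)
  qed
  then have "g x = 0" if "x \<in> {0..1}" "x \<notin> N \<union> {0, 1}" for x
    using that by (cases "x = 1") auto
  moreover have "negligible (N \<union> {0, 1})"
    using N(1) by (auto intro!: negligible_insert[THEN iffD2])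
  ultimately have "AE x in lebesgue. x \<in> {0..1} \<longrightarrow> g x = 0"
    by (intro AE_I'[of "N \<union> {0, 1}"]) (use negligible_iff_null_sets in blast)+
  then show ?thesis
    by (simp add: AE_restrict_space_iff)
qed

lemma integral_deriv_test_function:
  assumes "\<phi> \<in> test_functions"
  shows "integral\<^sup>L (lebesgue_on {0..1}) (deriv \<phi>) = 0"
proof -
  have "(deriv ^^ n) \<phi> differentiable (at x)" for n x
    using assms by (auto simp: test_functions_def)
  from this[of 0] this[of 1] have diff: "\<phi> differentiable (at x)" "deriv \<phi> differentiable (at x)" for x
    by auto
  have cont: "continuous_on {0..1} (deriv \<phi>)"
    using diff by (auto intro!: continuous_at_imp_continuous_on differentiable_imp_continuous_within)
  have "\<phi> x = 0" if "x \<notin> {0<..<1}" for x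
    using assms closure_subset[of "{x. \<phi> x \<noteq> 0}"] that by (auto simp: test_functions_def)
  then have "\<phi> 0 = 0" "\<phi> 1 = 0" by auto
  moreover have "(deriv \<phi> has_integral (\<phi> 1 - \<phi> 0)) {0..1}"
    using diff(1) by (intro fundamental_theorem_of_calculus)
      (auto simp: has_real_derivative_iff_has_vector_derivative[symmetric] DERIV_deriv_iff_real_differentiable
        intro: has_field_derivative_at_within)
  ultimately have "integral {0..1} (deriv \<phi>) = 0" by (simp add: integral_unique)
  moreover have "integrable (lebesgue_on {0..1}) (deriv \<phi>)"
    by (rule continuous_imp_integrable_real[OF cont])
  ultimately show ?thesis
    by (simp add: lebesgue_integral_eq_integral)
qed

text \<open>The zero function is one weak derivative, so the chosen one is a weak derivative too.
  Since test functions have derivatives of integral 0, any weak derivative of a constant is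
  orthogonal to all test functions.\<close>

lemma const_H1_unit:
  assumes f: "\<And>x. x \<in> {0..1} \<Longrightarrow> f x = c"
  shows "f \<in> H1_unit" "AE x in lebesgue_on {0..1}. weak_deriv f x = 0"
proof -
  have zero: "integral\<^sup>L (lebesgue_on {0..1}) (\<lambda>x. f x * deriv \<phi> x) = 0" if "\<phi> \<in> test_functions" for \<phi>
  proof -
    have "integral\<^sup>L (lebesgue_on {0..1}) (\<lambda>x. f x * deriv \<phi> x)
        = integral\<^sup>L (lebesgue_on {0..1}) (\<lambda>x. c * deriv \<phi> x)"
      by (rule Bochner_Integration.integral_cong) (auto simp: f)
    then show ?thesis using integral_deriv_test_function[OF that] by simp
  qed
  have "f \<in> borel_measurable (lebesgue_on {0..1})"
    by (subst measurable_cong[where g = "\<lambda>_. c"]) (auto simp: f)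
  moreover have "integrable (lebesgue_on {0..1}) (\<lambda>x. (f x)\<^sup>2)"
    by (subst Bochner_Integration.integrable_cong[OF refl, where g = "\<lambda>_. c\<^sup>2"])
       (auto simp: f integrable_on_const)
  moreover have weak: "is_weak_deriv f (\<lambda>_. 0)"
    using zero by (auto simp: is_weak_deriv_def L2_unit_def)
  ultimately show "f \<in> H1_unit" by (auto simp: H1_unit_def L2_unit_def)
  have "is_weak_deriv f (weak_deriv f)"
    unfolding weak_deriv_def by (rule someI[of "is_weak_deriv f", OF weak])
  then show "AE x in lebesgue_on {0..1}. weak_deriv f x = 0"
    using zero by (intro orthogonal_test_functions_AE_0) (auto simp: is_weak_deriv_def)
qed

lemma const_on_segment:
  assumes "\<And>x. x \<in> closed_segment a b \<Longrightarrow> u x = c"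
  shows "u \<in> H1_seg a b" "D_seg a b u u = 0"
proof -
  have "(u \<circ> xi a b) t = c" if "t \<in> {0..1}" for t
    using assms that by (auto simp: xi_def in_segment)
  note * = const_H1_unit[where f = "u \<circ> xi a b" and c = c, OF this]
  show "u \<in> H1_seg a b" using * by (simp add: H1_seg_def)
  show "D_seg a b u u = 0"
    unfolding D_seg_def by (rule integral_eq_zero_AE) (use *(2) in auto)
qed


section \<open>Attractors of iterated function systems\<close>

lemma infdist_contraction_le:
  fixes f :: "'a::metric_space \<Rightarrow> 'a"
  assumes "Y \<noteq> {}" "f ` Y \<subseteq> Y" "0 < c" "\<And>x y. dist (f x) (f y) \<le> c * dist x y"
  shows "infdist (f x) Y \<le> c * infdist x Y"
proof -
  have "infdist (f x) Y / c \<le> infdist x Y"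
    unfolding infdist_notempty[OF assms(1), of x]
  proof (rule cINF_greatest[OF assms(1)])
    fix y assume "y \<in> Y"
    then have "infdist (f x) Y \<le> dist (f x) (f y)"
      using assms(2) by (intro infdist_le) auto
    also have "\<dots> \<le> c * dist x y" by (rule assms)
    finally show "infdist (f x) Y / c \<le> dist x y"
      using assms(3) by (simp add: field_simps)
  qed
  then show ?thesis using assms(3) by (simp add: field_simps)
qed

text \<open>A point of \<open>X\<close> at maximal distance from \<open>Y\<close> would have to be the image of a point of \<open>X\<close>
  at least \<open>1/c\<close> times as far away.\<close>

lemma ifs_subset:
  fixes f :: "'i \<Rightarrow> 'a::metric_space \<Rightarrow> 'a"
  assumes X: "compact X" and Y: "closed Y" "Y \<noteq> {}" and c: "0 < c" "c < 1"
    and contr: "\<And>i x y. i \<in> I \<Longrightarrow> dist (f i x) (f i y) \<le> c * dist x y"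
    and inv: "\<And>i. i \<in> I \<Longrightarrow> f i ` Y \<subseteq> Y"
    and sub: "X \<subseteq> Y \<union> (\<Union>i\<in>I. f i ` X)"
  shows "X \<subseteq> Y"
proof (cases "X = {}")
  case False
  have "continuous_on X (\<lambda>x. infdist x Y)"
    by (intro continuous_intros)
  then obtain x where x: "x \<in> X" "\<And>y. y \<in> X \<Longrightarrow> infdist y Y \<le> infdist x Y"
    using continuous_attains_sup[OF X False] by blast
  have "infdist x Y = 0"
  proof (cases "x \<in> Y")
    case False
    then obtain i y where i: "i \<in> I" "y \<in> X" "x = f i y"
      using sub x(1) by blast
    have "infdist x Y \<le> c * infdist y Y"
      unfolding i(3) by (rule infdist_contraction_le) (use i Y c contr inv in auto)
    also have "\<dots> \<le> c * infdist x Y"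
      using x i c by (intro mult_left_mono) auto
    finally have "(1 - c) * infdist x Y \<le> 0" by (simp add: algebra_simps)
    then show ?thesis
      using c infdist_nonneg[of x Y] by (simp add: mult_le_0_iff)
  qed simp
  then have "infdist y Y = 0" if "y \<in> X" for y
    using x(2)[OF that] infdist_nonneg[of y Y] by simp
  then show ?thesis
    using in_closed_iff_infdist_zero[OF Y] by auto
qed simp

lemma contraction_continuous_on:
  fixes f :: "'a::metric_space \<Rightarrow> 'b::metric_space"
  assumes "\<And>x y. dist (f x) (f y) \<le> c * dist x y"
  shows "continuous_on A f"
proof (rule continuous_on_subset)
  \<comment> \<open>A Lipschitz constant has to be nonnegative, which is not assumed of
    \<open>c\<close>.\<close>
  have "dist (f x) (f y) \<le> max c 0 * dist x y" for x y
    by (rule order_trans[OF assms]) (simp add: mult_right_mono)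
  then show "continuous_on UNIV f"
    by (intro lipschitz_on_continuous_on[of "max c 0"] lipschitz_onI) auto
qed simp

text \<open>The attractor is the largest set in a big invariant ball with \<open>X \<subseteq> \<Union>\<^sub>i f\<^sub>i(X) \<union> C\<close>: it is a
  fixed point by the Knaster-Tarski argument, and it is closed because its closure is a
  competitor.\<close>

lemma ifs_attractor_exists:
  fixes f :: "'i \<Rightarrow> 'a::euclidean_space \<Rightarrow> 'a"
  assumes I: "finite I" "I \<noteq> {}" and c: "0 < c" "c < 1" and C: "compact C"
    and contr: "\<And>i x y. i \<in> I \<Longrightarrow> dist (f i x) (f i y) \<le> c * dist x y"
  shows "\<exists>X. compact X \<and> X \<noteq> {} \<and> X = (\<Union>i\<in>I. f i ` X) \<union> C"
proof -
  define \<Phi> where "\<Phi> X = (\<Union>i\<in>I. f i ` X) \<union> C" for X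
  obtain b where b: "\<And>x. x \<in> C \<Longrightarrow> norm x \<le> b"
    using compact_imp_bounded[OF C] bounded_iff by blast
  \<comment> \<open>The first bound makes the ball contain \<open>C\<close>; the second gives
    \<open>norm (f i 0) + c * R \<le> R\<close>, so that the ball is mapped into itself.\<close>
  define R where "R = max \<bar>b\<bar> ((\<Sum>i\<in>I. norm (f i 0)) / (1 - c))"
  define T where "T = cball (0::'a) R"
  have R: "norm (f i 0) \<le> (1 - c) * R" if "i \<in> I" for i
  proof -
    have "norm (f i 0) \<le> (\<Sum>i\<in>I. norm (f i 0))"
      using I that by (intro member_le_sum) auto
    also have "\<dots> \<le> (1 - c) * R"
      using c by (simp add: R_def field_simps max_def)
    finally show ?thesis .
  qed
  have inv: "\<Phi> T \<subseteq> T"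
  proof -
    have "norm (f i x) \<le> R" if "i \<in> I" "norm x \<le> R" for i x
    proof -
      have "norm (f i x) \<le> norm (f i 0) + dist (f i x) (f i 0)"
        by (metis dist_norm norm_triangle_sub)
      also have "dist (f i x) (f i 0) \<le> c * R"
        using contr[OF that(1), of x 0] that(2) c
        by (smt (verit) dist_0_norm dist_commute mult_left_mono)
      finally show ?thesis using R[OF that(1)] by (simp add: algebra_simps)
    qed
    moreover have "norm x \<le> R" if "x \<in> C" for x
      using b[OF that] by (simp add: R_def)
    ultimately show ?thesis by (auto simp: \<Phi>_def T_def)
  qed
  have cont: "continuous_on A (f i)" if "i \<in> I" for i A
    by (rule contraction_continuous_on[OF contr[OF that]])
  have mono: "\<Phi> A \<subseteq> \<Phi> A'" if "A \<subseteq> A'" for A A'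
    using that by (auto simp: \<Phi>_def)
  define X where "X = \<Union>{A. A \<subseteq> T \<and> A \<subseteq> \<Phi> A}"
  have XT: "X \<subseteq> T" by (auto simp: X_def)
  have X1: "X \<subseteq> \<Phi> X"
    unfolding X_def
  proof (rule Union_least)
    fix A assume A: "A \<in> {A. A \<subseteq> T \<and> A \<subseteq> \<Phi> A}"
    then have "A \<subseteq> \<Phi> A" by simp
    also have "\<Phi> A \<subseteq> \<Phi> (\<Union>{A. A \<subseteq> T \<and> A \<subseteq> \<Phi> A})" by (rule mono[OF Union_upper[OF A]])
    finally show "A \<subseteq> \<Phi> (\<Union>{A. A \<subseteq> T \<and> A \<subseteq> \<Phi> A})" .
  qed
  have X2: "\<Phi> X \<subseteq> X"
    unfolding X_def
    by (rule Union_upper) (use mono[OF X1] mono[OF XT] inv in \<open>simp add: X_def[symmetric]\<close>)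
  have clX: "compact (closure X)"
    using XT by (auto simp: T_def compact_closure intro: bounded_subset)
  have "closed (\<Phi> (closure X))"
    unfolding \<Phi>_def using I C clX cont
    by (intro closed_Un compact_imp_closed compact_UN compact_continuous_image) auto
  then have "closure X \<subseteq> \<Phi> (closure X)"
    using X1 mono[OF closure_subset[of X]] by (intro closure_minimal) auto
  moreover have "closure X \<subseteq> T"
    using XT by (intro closure_minimal) (auto simp: T_def)
  ultimately have "closure X \<subseteq> X"
    unfolding X_def by (intro Union_upper) simp
  then have "compact X"
    using clX closure_subset[of X] by (simp add: subset_antisym)
  \<comment> \<open>The set \<open>C\<close> may be empty, so a point is taken from elsewhere: the
    singleton of a fixed point of some \<open>f i\<close> is a competitor in the union.\<close>
  moreover have "X \<noteq> {}"
  proof -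
    from I obtain i where i: "i \<in> I" by auto
    have "\<exists>!x. f i x = x"
      by (rule banach_fix_type[of c]) (use c contr[OF i] in auto)
    then obtain x where x: "f i x = x" by auto
    have "(1 - c) * norm x \<le> norm (f i 0)"
      using contr[OF i, of x 0] x norm_triangle_sub[of x "f i 0"] by (simp add: dist_norm algebra_simps)
    with R[OF i] have "(1 - c) * norm x \<le> (1 - c) * R" by simp
    then have "norm x \<le> R" using c by simp
    then have "{x} \<subseteq> T" "{x} \<subseteq> \<Phi> {x}" using i x by (auto simp: T_def \<Phi>_def intro!: bexI[of _ i])
    then show ?thesis unfolding X_def by blast
  qed
  moreover have "X = \<Phi> X" using X1 X2 by auto
  ultimately show ?thesis unfolding \<Phi>_def by blast
qed

lemma ifs_attractor_unique:
  fixes f :: "'i \<Rightarrow> 'a::metric_space \<Rightarrow> 'a"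
  assumes c: "0 < c" "c < 1"
    and contr: "\<And>i x y. i \<in> I \<Longrightarrow> dist (f i x) (f i y) \<le> c * dist x y"
    and X: "compact X" "X \<noteq> {}" "X = (\<Union>i\<in>I. f i ` X) \<union> C"
    and Y: "compact Y" "Y \<noteq> {}" "Y = (\<Union>i\<in>I. f i ` Y) \<union> C"
  shows "X = Y"
proof
  have "X \<subseteq> Y \<union> (\<Union>i\<in>I. f i ` X)" "Y \<subseteq> X \<union> (\<Union>i\<in>I. f i ` Y)"
    using X(3) Y(3) by blast+
  note sub = this
  have inv: "f i ` X \<subseteq> X" "f i ` Y \<subseteq> Y" if "i \<in> I" for i
    using X(3) Y(3) that by blast+
  show "X \<subseteq> Y"
    by (rule ifs_subset[OF X(1) compact_imp_closed[OF Y(1)] Y(2) c contr inv(2) sub(1)])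
  show "Y \<subseteq> X"
    by (rule ifs_subset[OF Y(1) compact_imp_closed[OF X(1)] X(2) c contr inv(1) sub(2)])
qed

section \<open>Finite words, cylinders and addresses\<close>

lemma comp_word_Nil [simp]: "comp_word f [] x = x"
  and comp_word_Cons [simp]: "comp_word f (i # w) x = f i (comp_word f w x)"
  and comp_word_append: "comp_word f (w @ w') x = comp_word f w (comp_word f w' x)"
proof -
  show "comp_word f [] x = x" "comp_word f (i # w) x = f i (comp_word f w x)" for i w x
    by (auto simp: comp_word_def)
  then show "comp_word f (w @ w') x = comp_word f w (comp_word f w' x)"
    by (induction w) auto
qed

lemma comp_word_invariant:
  assumes "set w \<subseteq> I" "\<And>i. i \<in> I \<Longrightarrow> f i ` A \<subseteq> A" "x \<in> A"
  shows "comp_word f w x \<in> A"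
  using assms(1) by (induction w) (use assms in auto)

lemma comp_word_semiconj:
  assumes "set w \<subseteq> I" "\<And>i. i \<in> I \<Longrightarrow> f i ` A \<subseteq> A"
    "\<And>i x. i \<in> I \<Longrightarrow> x \<in> A \<Longrightarrow> g (f i x) = h i (g x)" "x \<in> A"
  shows "g (comp_word f w x) = comp_word h w (g x)"
  using assms(1)
proof (induction w)
  case (Cons i w)
  then have "comp_word f w x \<in> A"
    using assms by (intro comp_word_invariant[of w I]) auto
  then show ?case using Cons assms by auto
qed simp

lemma comp_word_contraction:
  assumes "set w \<subseteq> I" "0 \<le> c" "\<And>i x y. i \<in> I \<Longrightarrow> dist (f i x) (f i y) \<le> c * dist x y"
  shows "dist (comp_word f w x) (comp_word f w y) \<le> c ^ length w * dist x y"
  using assms(1)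
proof (induction w)
  case (Cons i w)
  have "dist (comp_word f (i # w) x) (comp_word f (i # w) y)
      \<le> c * dist (comp_word f w x) (comp_word f w y)"
    using Cons.prems assms by auto
  also have "\<dots> \<le> c * (c ^ length w * dist x y)"
    using Cons assms by (intro mult_left_mono) auto
  finally show ?case by (simp add: mult_ac)
qed simp

lemma set_prefix_infinite_word: "\<omega> \<in> infinite_words \<Longrightarrow> set (map \<omega> [0..<m]) \<subseteq> S"
  by (auto simp: infinite_words_def)

lemma cylinders_singleton:
  fixes f :: "nat \<Rightarrow> 'a::metric_space \<Rightarrow> 'a"
  assumes \<omega>: "\<omega> \<in> infinite_words" and c: "0 < c" "c < 1"
    and contr: "\<And>i x y. i \<in> S \<Longrightarrow> dist (f i x) (f i y) \<le> c * dist x y"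
    and A: "compact A" and x: "\<And>m. x \<in> comp_word f (map \<omega> [0..<m]) ` A"
  shows "cylinders f A \<omega> = {x}"
proof -
  obtain b where b: "\<And>y z. y \<in> A \<Longrightarrow> z \<in> A \<Longrightarrow> dist y z \<le> b"
    using compact_imp_bounded[OF A] bounded_two_points by metis
  have "y = x" if y: "y \<in> cylinders f A \<omega>" for y
  proof -
    have "dist y x \<le> c ^ m * b" for m
    proof -
      have "y \<in> comp_word f (map \<omega> [0..<m]) ` A"
        using y by (auto simp: cylinders_def)
      with x[of m] obtain x' y' where *: "x' \<in> A" "y' \<in> A"
        "x = comp_word f (map \<omega> [0..<m]) x'" "y = comp_word f (map \<omega> [0..<m]) y'"
        by blast
      have "dist y x \<le> c ^ length (map \<omega> [0..<m]) * dist y' x'"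
        unfolding * by (rule comp_word_contraction[OF set_prefix_infinite_word[OF \<omega>]])
          (use c contr in auto)
      also have "\<dots> \<le> c ^ m * b"
        using b[OF *(2,1)] c by (auto intro!: mult_left_mono)
      finally show ?thesis .
    qed
    moreover have "(\<lambda>m. c ^ m * b) \<longlonglongrightarrow> 0 * b"
      using c by (intro tendsto_intros LIMSEQ_realpow_zero) auto
    ultimately have "dist y x \<le> 0 * b"
      by (intro LIMSEQ_le_const) auto
    then show ?thesis by simp
  qed
  then show ?thesis using x by (auto simp: cylinders_def)
qed

text \<open>The address is an itinerary: choose for each point a cell \<open>d x\<close> containing
  it and a preimage \<open>t x\<close> there, and record the cells met along the orbit of
  \<open>t\<close>.\<close>

lemma ifs_address_exists:
  assumes A: "A = (\<Union>i\<in>S. f i ` A)" and x: "x \<in> A"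
  obtains \<omega> where "\<omega> \<in> infinite_words" "\<And>m. x \<in> comp_word f (map \<omega> [0..<m]) ` A"
proof -
  have "\<forall>x\<in>A. \<exists>i y. i \<in> S \<and> y \<in> A \<and> x = f i y"
    using A by blast
  then obtain d t where dt: "\<And>x. x \<in> A \<Longrightarrow> d x \<in> S" "\<And>x. x \<in> A \<Longrightarrow> t x \<in> A"
    "\<And>x. x \<in> A \<Longrightarrow> x = f (d x) (t x)" by metis
  have it: "(t ^^ m) x \<in> A" for m
    by (induction m) (use dt x in auto)
  have "x = comp_word f (map (\<lambda>n. d ((t ^^ n) x)) [0..<m]) ((t ^^ m) x)" for m
  proof (induction m)
    case (Suc m)
    with dt(3)[OF it[of m]] show ?case by (simp add: comp_word_append)
  qed simp
  with it dt(1) that[of "\<lambda>n. d ((t ^^ n) x)"] show thesis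
    by (auto simp: infinite_words_def)
qed


section \<open>Geometry of the cells\<close>

text \<open>The unstretched maps are the case \<beta> = 0, so the incidence geometry of cells is
  proved once for all \<beta> in [0,1).\<close>

lemma F_eq_G: "F p = G p 0"
  by (intro ext) (simp add: F_def G_def)

lemma dist_G: "\<beta> < 1 \<Longrightarrow> dist (G p \<beta> i x) (G p \<beta> i y) = (1 - \<beta>) / 2 * dist x y"
proof -
  assume "\<beta> < 1"
  have "G p \<beta> i x - G p \<beta> i y = ((1 - \<beta>) / 2) *\<^sub>R (x - y)"
    by (simp add: G_def algebra_simps)
  then show ?thesis using \<open>\<beta> < 1\<close> by (simp add: dist_norm)
qed

lemma G_inj: "\<beta> < 1 \<Longrightarrow> G p \<beta> i x = G p \<beta> i y \<longleftrightarrow> x = y"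
  by (metis dist_G dist_eq_0_iff mult_eq_0_iff diff_gt_0_iff_gt half_gt_zero less_irrefl)

lemma G_fixed [simp]: "G p \<beta> i (p i) = p i"
  by (simp add: G_def)

locale triangle =
  fixes p :: "nat \<Rightarrow> real^2"
  assumes regular: "regular_triangle p"
begin

lemma sum_p: "p 1 + p 2 + p 3 = 0"
  using regular by (simp add: regular_triangle_def)

lemma inner_p: "i \<in> S \<Longrightarrow> j \<in> S \<Longrightarrow> p i \<bullet> p j = (if i = j then 1/3 else - 1/6)"
proof -
  have p3: "p 3 = - p 1 - p 2"
  proof -
    have "p 3 = (p 1 + p 2 + p 3) - p 1 - p 2" by simp
    then show ?thesis unfolding sum_p by simp
  qed
  have "dist (p i) (p j) = 1 \<Longrightarrow> (p i - p j) \<bullet> (p i - p j) = 1" for i j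
    by (simp add: dist_norm dot_square_norm)
  then have *: "(p 1 - p 2) \<bullet> (p 1 - p 2) = 1" "(p 1 - p 3) \<bullet> (p 1 - p 3) = 1"
    "(p 2 - p 3) \<bullet> (p 2 - p 3) = 1"
    using regular by (auto simp: regular_triangle_def S_def)
  \<comment> \<open>With \<open>p 3\<close> eliminated, the three side lengths become a linear
    system for the three inner products of \<open>p 1\<close> and \<open>p 2\<close>.\<close>
  have expand: "(a - b) \<bullet> (a - b) = a \<bullet> a - 2 * (a \<bullet> b) + b \<bullet> b"
    "(a - (- a - b)) \<bullet> (a - (- a - b)) = 4 * (a \<bullet> a) + 4 * (a \<bullet> b) + b \<bullet> b"
    "(b - (- a - b)) \<bullet> (b - (- a - b)) = 4 * (b \<bullet> b) + 4 * (a \<bullet> b) + a \<bullet> a" for a b :: "real^2"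
    by (simp_all only: inner_diff_left inner_diff_right inner_minus_left inner_minus_right
        inner_commute[of b a])
  have "p 1 \<bullet> p 1 = 1/3" "p 2 \<bullet> p 2 = 1/3" "p 1 \<bullet> p 2 = - 1/6"
    using *[unfolded p3, unfolded expand(2,3), unfolded expand(1)] by linarith+
  note 12 = this
  have 3: "p 1 \<bullet> p 3 = - 1/6" "p 2 \<bullet> p 3 = - 1/6" "p 3 \<bullet> p 3 = 1/3"
    using 12 unfolding p3 inner_diff_left inner_diff_right inner_minus_left inner_minus_right
      inner_commute[of "p 2" "p 1"] by linarith+
  show "i \<in> S \<Longrightarrow> j \<in> S \<Longrightarrow> p i \<bullet> p j = (if i = j then 1/3 else - 1/6)"
    using 12 3 by (auto simp: S_def inner_commute)
qed

text \<open>The vertices \<open>p 1\<close> and \<open>p 2\<close> span the plane: by Lagrange's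
  identity the square of their determinant is the Gram determinant 1/9 - 1/36 = 1/12.\<close>

lemma inner_p_eqI:
  assumes "\<And>k. k \<in> S \<Longrightarrow> x \<bullet> p k = y \<bullet> p k"
  shows "x = y"
proof -
  define v where "v = x - y"
  define a b c d where "a = p 1 $ 1" and "b = p 1 $ 2" and "c = p 2 $ 1" and "d = p 2 $ 2"
  have v: "v $ 1 * a + v $ 2 * b = 0" "v $ 1 * c + v $ 2 * d = 0"
    using assms[of 1] assms[of 2]
    by (auto simp: v_def a_def b_def c_def d_def S_def inner_vec_def sum_2 algebra_simps)
  have prods: "a * a + b * b = 1/3" "c * c + d * d = 1/3" "a * c + b * d = - 1/6"
    using inner_p[of 1 1] inner_p[of 2 2] inner_p[of 1 2]
    by (auto simp: a_def b_def c_def d_def S_def inner_vec_def sum_2)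
  have "(a * d - b * c)\<^sup>2 = (a * a + b * b) * (c * c + d * d) - (a * c + b * d)\<^sup>2"
    by (simp add: power2_eq_square algebra_simps)
  also have "\<dots> = 1/12" unfolding prods by (simp add: power2_eq_square)
  finally have det: "a * d - b * c \<noteq> 0" by auto
  have "v $ 1 * (a * d - b * c) = 0" "v $ 2 * (a * d - b * c) = 0"
    using v by algebra+
  with det have "v $ 1 = 0" "v $ 2 = 0" by auto
  then have "v = 0" by (simp add: vec_eq_iff forall_2)
  then show ?thesis by (simp add: v_def)
qed

text \<open>The barycentric coordinates with respect to the triangle.\<close>

definition lam :: "nat \<Rightarrow> real^2 \<Rightarrow> real" where
  "lam k x = 1/3 + 2 * (x \<bullet> p k)"

lemma lam_p: "i \<in> S \<Longrightarrow> k \<in> S \<Longrightarrow> lam k (p i) = (if i = k then 1 else 0)"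
  by (simp add: lam_def inner_p)

lemma lam_sum: "lam 1 x + lam 2 x + lam 3 x = 1"
proof -
  have "x \<bullet> (p 1 + p 2 + p 3) = 0" by (simp only: sum_p inner_zero_right)
  then show ?thesis unfolding lam_def inner_add_right by simp
qed

lemma lam_eqI: "(\<And>k. k \<in> S \<Longrightarrow> lam k x = lam k y) \<Longrightarrow> x = y"
  by (rule inner_p_eqI) (simp add: lam_def)

lemma lam_affine: "s + t = 1 \<Longrightarrow> lam k (s *\<^sub>R x + t *\<^sub>R y) = s * lam k x + t * lam k y"
proof -
  assume "s + t = 1"
  then have "s * (1/3) + t * (1/3) = (1/3 :: real)" by (simp flip: distrib_right)
  then show ?thesis
    unfolding lam_def inner_add_left inner_scaleR_left by (simp add: algebra_simps)
qed

text \<open>In these coordinates a cell map is a scaling plus a shift of its own coordinate, which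
  turns incidence of cells and segments into linear inequalities.\<close>

lemma lam_G:
  assumes "i \<in> S" "k \<in> S"
  shows "lam k (G p \<beta> i x) = (1 - \<beta>) / 2 * lam k x + (if i = k then 1 - (1 - \<beta>) / 2 else 0)"
proof -
  have "G p \<beta> i x = ((1 - \<beta>) / 2) *\<^sub>R x + (1 - (1 - \<beta>) / 2) *\<^sub>R p i"
    by (simp add: G_def scaleR_diff_right scaleR_diff_left)
  then show ?thesis using assms by (simp add: lam_affine lam_p)
qed

text \<open>The closed triangle with vertices \<open>p 1\<close>, \<open>p 2\<close>,
  \<open>p 3\<close>.\<close>

definition T :: "(real^2) set" where
  "T = {x. \<forall>k\<in>S. 0 \<le> lam k x}"

lemma closed_T: "closed T"
proof -
  have "T = (\<Inter>k\<in>S. {x. 0 \<le> lam k x})" by (auto simp: T_def)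
  then show ?thesis
    by (auto simp: lam_def intro!: closed_Collect_le continuous_intros)
qed

lemma p_in_T: "i \<in> S \<Longrightarrow> p i \<in> T"
  by (auto simp: T_def lam_p)

lemma vertexI:
  assumes "x \<in> T" "i \<in> S" "1 \<le> lam i x"
  shows "x = p i"
proof (rule lam_eqI)
  have "0 \<le> lam 1 x" "0 \<le> lam 2 x" "0 \<le> lam 3 x"
    using assms by (auto simp: T_def S_def)
  then show "lam k x = lam k (p i)" if "k \<in> S" for k
    unfolding lam_p[OF assms(2) that] using assms(2,3) that lam_sum[of x] by (auto simp: S_def)
qed

lemma lam_le_1: "x \<in> T \<Longrightarrow> k \<in> S \<Longrightarrow> lam k x \<le> 1"
  using lam_sum[of x] by (auto simp: T_def S_def)

text \<open>The segment joining cells \<open>i\<close> and \<open>j\<close> at level one. For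
  \<beta> = 0 both ends coincide and it is the common point of the two cells.\<close>

definition gseg :: "real \<Rightarrow> nat \<Rightarrow> nat \<Rightarrow> (real^2) set" where
  "gseg \<beta> i j = closed_segment (G p \<beta> i (p j)) (G p \<beta> j (p i))"

text \<open>With \<open>c = (1 - \<beta>) / 2\<close>, the coordinates \<open>i\<close> and
  \<open>j\<close> are \<open>1 - c\<close> and \<open>c\<close> at one end and swapped at the
  other, while the third is 0 at both; affinity fills in the rest, as
  \<open>c \<le> 1/2\<close>.\<close>

lemma lam_gseg:
  assumes "x \<in> gseg \<beta> i j" "i \<in> S" "j \<in> S" "i \<noteq> j" "0 \<le> \<beta>" "\<beta> < 1"
  shows "(1 - \<beta>) / 2 \<le> lam i x" "lam i x \<le> 1 - (1 - \<beta>) / 2"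
    "(1 - \<beta>) / 2 \<le> lam j x" "lam j x \<le> 1 - (1 - \<beta>) / 2"
    "k \<in> S \<Longrightarrow> k \<noteq> i \<Longrightarrow> k \<noteq> j \<Longrightarrow> lam k x = 0"
proof -
  define c where "c = (1 - \<beta>) / 2"
  have c: "0 < c" "c \<le> 1/2" using assms by (auto simp: c_def)
  obtain t where t: "0 \<le> t" "t \<le> 1"
    "x = (1 - t) *\<^sub>R G p \<beta> i (p j) + t *\<^sub>R G p \<beta> j (p i)"
    using assms(1) by (auto simp: gseg_def in_segment)
  have lam: "lam k x = (1 - t) * lam k (G p \<beta> i (p j)) + t * lam k (G p \<beta> j (p i))" for k
    unfolding t(3) by (rule lam_affine) simp
  have "0 \<le> (1 - t) * (1 - 2 * c)" "0 \<le> t * (1 - 2 * c)" using t c by auto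
  moreover have "lam i x = c + (1 - t) * (1 - 2 * c)" "lam i x = 1 - c - t * (1 - 2 * c)"
    "lam j x = c + t * (1 - 2 * c)" "lam j x = 1 - c - (1 - t) * (1 - 2 * c)"
    using assms(2,3,4) by (simp_all add: lam lam_G lam_p c_def[symmetric] algebra_simps)
  ultimately show "(1 - \<beta>) / 2 \<le> lam i x" "lam i x \<le> 1 - (1 - \<beta>) / 2"
    "(1 - \<beta>) / 2 \<le> lam j x" "lam j x \<le> 1 - (1 - \<beta>) / 2"
    unfolding c_def[symmetric] by linarith+
  show "lam k x = 0" if "k \<in> S" "k \<noteq> i" "k \<noteq> j"
    using assms(2,3) that by (simp add: lam lam_G lam_p)
qed

lemma B_D: "(i, j) \<in> B \<Longrightarrow> i \<in> S \<and> j \<in> S \<and> i \<noteq> j"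
  by (auto simp: B_def S_def)

lemma G_in_T: "i \<in> S \<Longrightarrow> x \<in> T \<Longrightarrow> \<beta> < 1 \<Longrightarrow> 0 \<le> \<beta> \<Longrightarrow> G p \<beta> i x \<in> T"
  by (auto simp: T_def lam_G)

lemma gseg_subset_T: "(i, j) \<in> B \<Longrightarrow> \<beta> < 1 \<Longrightarrow> 0 \<le> \<beta> \<Longrightarrow> gseg \<beta> i j \<subseteq> T"
proof
  fix x assume *: "(i, j) \<in> B" "\<beta> < 1" "0 \<le> \<beta>" "x \<in> gseg \<beta> i j"
  have "0 \<le> lam k x" if "k \<in> S" for k
    using lam_gseg(1-4)[OF *(4)] lam_gseg(5)[OF *(4), of k] B_D[OF *(1)] * that by (cases "k = i \<or> k = j") force+
  then show "x \<in> T" by (simp add: T_def)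
qed

text \<open>Coordinate \<open>i\<close> is at least \<open>1 - c\<close> on cell \<open>i\<close>
  and at most \<open>c\<close> on cell \<open>j\<close>, where \<open>c \<le> 1/2\<close>. A common
  point forces equality throughout. The vertices are needed for gluing values, the conclusion
  \<beta> = 0 for separating the cells of the stretched gasket.\<close>

lemma cells_meet:
  assumes "i \<in> S" "j \<in> S" "i \<noteq> j" "x \<in> T" "y \<in> T" "0 \<le> \<beta>" "\<beta> < 1"
    and eq: "G p \<beta> i x = G p \<beta> j y"
  shows "x = p j" "y = p i" "\<beta> = 0"
proof -
  define c where "c = (1 - \<beta>) / 2"
  have c: "0 < c" "c \<le> 1/2" using assms by (auto simp: c_def)
  have *: "c * lam i x + 1 - c = c * lam i y" "c * lam j x = c * lam j y + 1 - c"
    using arg_cong[OF eq, of "lam i"] arg_cong[OF eq, of "lam j"] assms(1-3)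
    by (simp_all add: lam_G c_def[symmetric])
  have "0 \<le> lam i x" "0 \<le> lam j y" "lam i y \<le> 1" "lam j x \<le> 1"
    using assms lam_le_1 by (auto simp: T_def)
  then have le: "0 \<le> c * lam i x" "0 \<le> c * lam j y" "c * lam i y \<le> c * 1" "c * lam j x \<le> c * 1"
    using c by (auto intro!: mult_left_mono mult_nonneg_nonneg simp del: mult_1_right)
  have "c * 1 \<le> c * lam j x" "c * 1 \<le> c * lam i y" using * le c by linarith+
  then have "1 \<le> lam j x" "1 \<le> lam i y" using c by (auto simp: mult_le_cancel_left)
  then show "x = p j" "y = p i"
    using assms by (auto intro: vertexI)
  have "c = 1/2" using * le c by linarith
  then show "\<beta> = 0" by (simp add: c_def)
qed

text \<open>On cell \<open>k\<close> coordinate \<open>k\<close> is at least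
  \<open>1 - c > 0\<close>, so \<open>k\<close> must be \<open>i\<close> or \<open>j\<close>, the
  third coordinate being 0 on the segment. There coordinate \<open>k\<close> is also at most
  \<open>1 - c\<close>, which leaves \<open>x\<close> only the other vertex.\<close>

lemma cell_meets_gseg:
  assumes "k \<in> S" "(i, j) \<in> B" "x \<in> T" "0 \<le> \<beta>" "\<beta> < 1" "G p \<beta> k x \<in> gseg \<beta> i j"
  shows "k = i \<and> x = p j \<or> k = j \<and> x = p i"
proof -
  define c where "c = (1 - \<beta>) / 2"
  have c: "0 < c" "c \<le> 1/2" using assms by (auto simp: c_def)
  note B = B_D[OF assms(2)]
  note seg = lam_gseg[OF assms(6), unfolded c_def[symmetric]]
  have pos: "0 \<le> lam n x" if "n \<in> S" for n using assms that by (auto simp: T_def)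
  have lam: "lam n (G p \<beta> k x) = c * lam n x + (if k = n then 1 - c else 0)" if "n \<in> S" for n
    using lam_G[OF assms(1) that] by (simp add: c_def)
  have cpos: "0 \<le> c * lam n x" if "n \<in> S" for n using pos[OF that] c by simp
  have "k = i \<or> k = j"
  proof (rule ccontr)
    assume "\<not> (k = i \<or> k = j)"
    then have "lam k (G p \<beta> k x) = 0" using seg(5)[of k] B assms by auto
    then show False using lam[OF assms(1)] cpos[OF assms(1)] c by simp
  qed
  have key: "x = p n" if n: "n \<in> S" "k \<noteq> n" "{k, n} = {i, j}" for n
  proof (rule vertexI[OF assms(3) n(1)])
    have "lam k (G p \<beta> k x) \<le> 1 - c" using seg(2,4) B assms n(3) \<open>k = i \<or> k = j\<close> by auto
    then have "lam k x \<le> 0"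
      using lam[OF assms(1)] c by (simp add: mult_le_0_iff)
    moreover have "lam l x = 0" if "l \<in> S" "l \<noteq> k" "l \<noteq> n" for l
    proof -
      have "lam l (G p \<beta> k x) = 0"
        using seg(5)[of l] B assms that n(3) by auto
      then show ?thesis using lam[OF that(1)] c that by simp
    qed
    moreover have "\<exists>l\<in>S. l \<noteq> k \<and> l \<noteq> n \<and> lam k x + lam n x + lam l x = 1"
      using lam_sum[of x] n assms(1) by (auto simp: S_def)
    ultimately show "1 \<le> lam n x" by fastforce
  qed
  from \<open>k = i \<or> k = j\<close> show ?thesis
    using key[of i] key[of j] B by auto
qed

text \<open>Distinct segments differ in an index: some coordinate is at least
  \<open>(1 - \<beta>) / 2\<close> on the first and 0 on the second.\<close>

lemma gsegs_disjoint:
  assumes "(i, j) \<in> B" "(i', j') \<in> B" "x \<in> gseg \<beta> i j" "x \<in> gseg \<beta> i' j'" "0 \<le> \<beta>" "\<beta> < 1"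
  shows "i = i' \<and> j = j'"
proof (rule ccontr)
  assume ne: "\<not> (i = i' \<and> j = j')"
  have c: "0 < (1 - \<beta>) / 2" using assms by simp
  have "\<exists>k\<in>S. (k = i \<or> k = j) \<and> k \<noteq> i' \<and> k \<noteq> j'"
    using assms(1,2) ne unfolding B_def S_def by (elim insertE emptyE) simp_all
  then obtain k where k: "k \<in> S" "k = i \<or> k = j" "k \<noteq> i'" "k \<noteq> j'" by blast
  have ij: "i \<in> S" "j \<in> S" "i \<noteq> j" and ij': "i' \<in> S" "j' \<in> S" "i' \<noteq> j'"
    using B_D assms(1,2) by auto
  have "(1 - \<beta>) / 2 \<le> lam k x"
    using k(2) lam_gseg(1,3)[OF assms(3) ij assms(5,6)] by auto
  moreover have "lam k x = 0"
    by (rule lam_gseg(5)[OF assms(4) ij' assms(5,6) k(1,3,4)])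
  ultimately show False using c by simp
qed

lemma edge_conv_gseg: "edge p \<beta> w i j = comp_word (G p \<beta>) w ` gseg \<beta> i j"
  by (simp add: edge_def gseg_def)

end


section \<open>Semiconjugacies of gaskets\<close>

lemma finite_S [simp]: "finite S" and S_nonempty [simp]: "S \<noteq> {}"
  by (auto simp: S_def)

lemma finite_B [simp]: "finite B"
  by (simp add: B_def)

context triangle
begin

lemma dist_G_le: "\<beta> < 1 \<Longrightarrow> dist (G p \<beta> i x) (G p \<beta> i y) \<le> (1 - \<beta>) / 2 * dist x y"
  by (simp add: dist_G)

text \<open>One notion for both sets: for \<beta> = 0 the segments are points that the cells of
  \<open>K_star\<close> contain anyway.\<close>

definition is_gasket :: "real \<Rightarrow> (real^2) set \<Rightarrow> bool" where
  "is_gasket \<beta> X \<longleftrightarrow> compact X \<and> X \<noteq> {} \<and>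
     X = (\<Union>i\<in>S. G p \<beta> i ` X) \<union> (\<Union>(i, j)\<in>B. gseg \<beta> i j)"

lemma gasket_G: "is_gasket \<beta> X \<Longrightarrow> i \<in> S \<Longrightarrow> G p \<beta> i ` X \<subseteq> X"
  unfolding is_gasket_def by blast

lemma gasket_gseg: "is_gasket \<beta> X \<Longrightarrow> (i, j) \<in> B \<Longrightarrow> gseg \<beta> i j \<subseteq> X"
  unfolding is_gasket_def by blast

lemma gasket_subset_T:
  assumes X: "is_gasket \<beta> X" and \<beta>: "0 \<le> \<beta>" "\<beta> < 1"
  shows "X \<subseteq> T"
proof (rule ifs_subset[where f = "G p \<beta>" and I = S and c = "(1 - \<beta>) / 2"])
  have "X \<subseteq> (\<Union>i\<in>S. G p \<beta> i ` X) \<union> (\<Union>(i, j)\<in>B. gseg \<beta> i j)"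
    using X by (simp add: is_gasket_def)
  also have "\<dots> \<subseteq> (\<Union>i\<in>S. G p \<beta> i ` X) \<union> T"
    using gseg_subset_T \<beta> by blast
  finally show "X \<subseteq> T \<union> (\<Union>i\<in>S. G p \<beta> i ` X)" by blast
  show "T \<noteq> {}" using p_in_T[of 1] by (auto simp: S_def)
qed (use X \<beta> closed_T G_in_T dist_G_le in \<open>auto simp: is_gasket_def\<close>)

text \<open>The singleton of the fixed point is contained in its own image under
  \<open>G p \<beta> i\<close>, which is the hypothesis of \<open>ifs_subset\<close>.\<close>

lemma p_in_attractor:
  assumes "compact X" "X \<noteq> {}" "\<And>j. j \<in> S \<Longrightarrow> G p \<beta> j ` X \<subseteq> X" "i \<in> S" "0 \<le> \<beta>" "\<beta> < 1"
  shows "p i \<in> X"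
proof -
  have "{p i} \<subseteq> X"
  proof (rule ifs_subset[where f = "G p \<beta>" and I = S and c = "(1 - \<beta>) / 2"])
    show "{p i} \<subseteq> X \<union> (\<Union>j\<in>S. G p \<beta> j ` {p i})"
      using assms(4) by (auto intro!: bexI[of _ i])
  qed (use assms dist_G_le in \<open>auto intro: compact_imp_closed\<close>)
  then show ?thesis by simp
qed

lemma G_eq_vertex:
  assumes "k \<in> S" "i \<in> S" "x \<in> T" "0 \<le> \<beta>" "\<beta> < 1" "G p \<beta> k x = p i"
  shows "k = i \<and> x = p i"
proof -
  have "k = i"
  proof (rule ccontr)
    assume "k \<noteq> i"
    then have "(1 - \<beta>) / 2 * lam k x + (1 - (1 - \<beta>) / 2) = 0"
      using lam_G[OF assms(1,1), of \<beta> x] lam_p[OF assms(2,1)] unfolding assms(6) by simp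
    moreover have "0 < (1 - \<beta>) / 2 * lam k x + (1 - (1 - \<beta>) / 2)"
      using assms by (intro add_nonneg_pos) (auto simp: T_def)
    ultimately show False by simp
  qed
  moreover have "x = p i"
    using assms(5,6) G_inj[OF assms(5), of p i x "p i"] \<open>k = i\<close> by simp
  ultimately show ?thesis by simp
qed

lemma gseg_no_vertex:
  assumes "k \<in> S" "(i, j) \<in> B" "0 \<le> \<beta>" "\<beta> < 1"
  shows "p k \<notin> gseg \<beta> i j"
proof
  assume x: "p k \<in> gseg \<beta> i j"
  have ij: "i \<in> S" "j \<in> S" "i \<noteq> j" using B_D assms(2) by auto
  have "lam k (p k) \<le> 1 - (1 - \<beta>) / 2 \<or> lam k (p k) = 0"
    using lam_gseg(2,4)[OF x ij assms(3,4)] lam_gseg(5)[OF x ij assms(3,4,1)] by metis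
  then show False using lam_p[OF assms(1,1)] assms(3,4) by simp
qed

text \<open>The graph of the map is the attractor of the product maps; two values over the same point
  form a pair in the attractor of \<open>(f\<^sub>i, f\<^sub>i)\<close>, which lies in the diagonal.\<close>

theorem gasket_semiconjugacy:
  fixes f :: "nat \<Rightarrow> 'b::euclidean_space \<Rightarrow> 'b" and q :: "nat \<Rightarrow> 'b"
  assumes X: "is_gasket \<beta> X" and \<beta>: "0 \<le> \<beta>" "\<beta> < 1" and d: "0 < d" "d < 1"
    and contr: "\<And>i x y. i \<in> S \<Longrightarrow> dist (f i x) (f i y) \<le> d * dist x y"
    and fix_q: "\<And>i. i \<in> S \<Longrightarrow> f i (q i) = q i"
    and glue: "\<And>i j. i \<in> S \<Longrightarrow> j \<in> S \<Longrightarrow> f i (q j) = f j (q i)"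
  obtains g where "continuous_on X g" "\<And>i x. i \<in> S \<Longrightarrow> x \<in> X \<Longrightarrow> g (G p \<beta> i x) = f i (g x)"
    "\<And>i j x. (i, j) \<in> B \<Longrightarrow> x \<in> gseg \<beta> i j \<Longrightarrow> g x = f i (q j)"
    "\<And>i. i \<in> S \<Longrightarrow> g (p i) = q i"
proof -
  define c where "c = (1 - \<beta>) / 2"
  have c: "0 < c" "c < 1" using \<beta> by (auto simp: c_def)
  have contr_G: "dist (G p \<beta> i x) (G p \<beta> i y) \<le> c * dist x y" for i x y
    using dist_G_le[OF \<beta>(2)] by (simp add: c_def)
  define h where "h i z = (G p \<beta> i (fst z), f i (snd z))" for i z
  define e where "e = max c d"
  have e: "0 < e" "e < 1" using c d by (auto simp: e_def)
  have contr_pair: "dist (u, v) (u', v') \<le> e * dist (a, b) (a', b')"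
    if "dist u u' \<le> e * dist a a'" "dist v v' \<le> e * dist b b'"
    for u u' a a' :: "'x::metric_space" and v v' b b' :: "'y::metric_space"
  proof -
    have "(dist u u')\<^sup>2 + (dist v v')\<^sup>2 \<le> (e * dist a a')\<^sup>2 + (e * dist b b')\<^sup>2"
      using that by (intro add_mono power_mono) auto
    also have "\<dots> = e\<^sup>2 * ((dist a a')\<^sup>2 + (dist b b')\<^sup>2)"
      by (simp add: power_mult_distrib algebra_simps)
    finally have "sqrt ((dist u u')\<^sup>2 + (dist v v')\<^sup>2) \<le> sqrt (e\<^sup>2 * ((dist a a')\<^sup>2 + (dist b b')\<^sup>2))"
      by (rule real_sqrt_le_mono)
    then show ?thesis using e by (simp add: dist_Pair_Pair real_sqrt_mult)
  qed
  have contr_G': "dist (G p \<beta> i x) (G p \<beta> i y) \<le> e * dist x y" for i x y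
    by (rule order_trans[OF contr_G]) (simp add: e_def mult_right_mono)
  have contr': "dist (f i x) (f i y) \<le> e * dist x y" if "i \<in> S" for i x y
    by (rule order_trans[OF contr[OF that]]) (simp add: e_def mult_right_mono)
  have contr_h: "dist (h i z) (h i z') \<le> e * dist z z'" if "i \<in> S" for i z z'
    unfolding h_def by (cases z, cases z') (simp add: contr_pair contr_G' contr'[OF that])
  define C where "C = (\<Union>(i, j)\<in>B. gseg \<beta> i j \<times> {f i (q j)})"
  have "compact C"
    unfolding C_def by (intro compact_UN) (auto simp: gseg_def intro!: compact_Times)
  then obtain M where M: "compact M" "M \<noteq> {}" "M = (\<Union>i\<in>S. h i ` M) \<union> C"
    using ifs_attractor_exists[of S e C h, OF finite_S S_nonempty e _ contr_h] by blast
  \<comment> \<open>Projecting the equation of \<open>M\<close> to the first factor gives the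
    equation of the gasket, whose nonempty compact solution is unique.\<close>
  have "fst ` M = X"
  proof (rule ifs_attractor_unique[OF c, of S "G p \<beta>"])
    have "fst ` M = (\<Union>i\<in>S. fst ` h i ` M) \<union> fst ` C"
      by (subst M(3)) (simp add: image_Un image_UN)
    also have "(\<Union>i\<in>S. fst ` h i ` M) = (\<Union>i\<in>S. G p \<beta> i ` fst ` M)"
      by (simp add: h_def image_image)
    also have "fst ` C = (\<Union>(i, j)\<in>B. gseg \<beta> i j)"
      by (force simp: C_def)
    finally show "fst ` M = (\<Union>i\<in>S. G p \<beta> i ` fst ` M) \<union> (\<Union>(i, j)\<in>B. gseg \<beta> i j)" .
    show "compact (fst ` M)"
      by (intro compact_continuous_image continuous_intros M(1))
  qed (use X M contr_G in \<open>auto simp: is_gasket_def\<close>)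
  then have M_T: "x \<in> T" if "(x, y) \<in> M" for x y
    using gasket_subset_T[OF X \<beta>] that by force
  have M_cases: "(\<exists>i\<in>S. \<exists>x' y'. (x', y') \<in> M \<and> x = G p \<beta> i x' \<and> y = f i y') \<or>
      (\<exists>i j. (i, j) \<in> B \<and> x \<in> gseg \<beta> i j \<and> y = f i (q j))" if "(x, y) \<in> M" for x y
  proof -
    have "(x, y) \<in> (\<Union>i\<in>S. h i ` M) \<union> C" using that M(3) by simp
    then show ?thesis by (auto simp: h_def C_def) blast+
  qed
  have M_G: "(G p \<beta> i x, f i y) \<in> M" if "i \<in> S" "(x, y) \<in> M" for i x y
  proof -
    have "h i (x, y) \<in> (\<Union>i\<in>S. h i ` M) \<union> C" using that by blast
    then have "h i (x, y) \<in> M" by (subst M(3))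
    then show ?thesis by (simp add: h_def)
  qed
  have M_seg: "(x, f i (q j)) \<in> M" if "(i, j) \<in> B" "x \<in> gseg \<beta> i j" for i j x
  proof -
    have "(x, f i (q j)) \<in> C" using that by (auto simp: C_def)
    then show ?thesis by (subst M(3)) blast
  qed
  \<comment> \<open>Only cell \<open>i\<close> reaches \<open>p i\<close>, and only from
    \<open>p i\<close> itself. The set of values over \<open>p i\<close> is therefore contained in
    its image under \<open>f i\<close> and shrinks to the fixed point \<open>q i\<close>.\<close>
  have vertex: "y = q i" if i: "i \<in> S" and y: "(p i, y) \<in> M" for i y
  proof -
    let ?Y = "snd ` (M \<inter> ({p i} \<times> UNIV))"
    have "?Y \<subseteq> {q i}"
    proof (rule ifs_subset[where f = f and I = "{i}" and c = d])
      show "compact ?Y"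
        by (intro compact_continuous_image continuous_intros compact_Int_closed M(1) closed_Times)
      show "?Y \<subseteq> {q i} \<union> (\<Union>j\<in>{i}. f j ` ?Y)"
      proof
        fix y assume "y \<in> ?Y"
        then have y: "(p i, y) \<in> M" by auto
        from M_cases[OF y] obtain k x' y' where
          k: "k \<in> S" "(x', y') \<in> M" "p i = G p \<beta> k x'" "y = f k y'"
          using gseg_no_vertex[OF i _ \<beta>] by blast
        have "k = i \<and> x' = p i"
          by (rule G_eq_vertex[OF k(1) i M_T[OF k(2)] \<beta>]) (simp add: k(3))
        then show "y \<in> {q i} \<union> (\<Union>j\<in>{i}. f j ` ?Y)"
          using k by force
      qed
    qed (use d contr i fix_q in auto)
    then show ?thesis using y by force
  qed
  have glue_B: "f i (q j) = f j (q i)" if "(i, j) \<in> B" for i j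
    using glue B_D[OF that] by auto
  \<comment> \<open>A value over a segment comes from that segment or from a cell touching it. In
    the latter case the preimage is a vertex, whose value is known, and gluing yields the same
    result from either end.\<close>
  have seg: "y = f i (q j)" if ij: "(i, j) \<in> B" and x: "x \<in> gseg \<beta> i j" and y: "(x, y) \<in> M" for i j x y
    using M_cases[OF y]
  proof (elim disjE bexE exE conjE)
    fix k x' y' assume k: "k \<in> S" "(x', y') \<in> M" "x = G p \<beta> k x'" "y = f k y'"
    have "k = i \<and> x' = p j \<or> k = j \<and> x' = p i"
      by (rule cell_meets_gseg[OF k(1) ij M_T[OF k(2)] \<beta>]) (use k x in simp)
    then show "y = f i (q j)"
      using vertex[of i] vertex[of j] k B_D[OF ij] glue_B[OF ij] by auto
  next
    fix k l assume "(k, l) \<in> B" "x \<in> gseg \<beta> k l" "y = f k (q l)"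
    then show "y = f i (q j)" using gsegs_disjoint[OF _ ij _ x \<beta>] by blast
  qed
  have unique: "y = y'" if "(x, y) \<in> M" "(x, y') \<in> M" for x y y'
  proof -
    let ?D = "(\<lambda>w. (snd (fst w), snd (snd w))) ` ((M \<times> M) \<inter> {w. fst (fst w) = fst (snd w)})"
    let ?E = "{z :: 'b \<times> 'b. fst z = snd z}"
    have sub: "?D \<subseteq> ?E"
    proof (rule ifs_subset[where f = "\<lambda>i z. (f i (fst z), f i (snd z))" and I = S and c = e])
      show "compact ?D"
        by (intro compact_continuous_image continuous_intros compact_Int_closed compact_Times M(1)
            closed_Collect_eq)
      show "closed ?E"
        by (intro closed_Collect_eq continuous_intros)
      show "dist (f i (fst x), f i (snd x)) (f i (fst y), f i (snd y)) \<le> e * dist x y"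
        if "i \<in> S" for i and x y :: "'b \<times> 'b"
        by (cases x, cases y) (simp add: contr_pair contr'[OF that])
      show "?D \<subseteq> ?E \<union> (\<Union>i\<in>S. (\<lambda>z. (f i (fst z), f i (snd z))) ` ?D)"
      proof
        fix w assume "w \<in> ?D"
        then obtain x y y' where w: "w = (y, y')" "(x, y) \<in> M" "(x, y') \<in> M" by auto
        show "w \<in> ?E \<union> (\<Union>i\<in>S. (\<lambda>z. (f i (fst z), f i (snd z))) ` ?D)"
        proof (cases "\<exists>i j. (i, j) \<in> B \<and> x \<in> gseg \<beta> i j")
          case True
          then obtain i j where ij: "(i, j) \<in> B" "x \<in> gseg \<beta> i j" by blast
          have "y = y'" using seg[OF ij w(2)] seg[OF ij w(3)] by simp
          then show ?thesis using w(1) by simp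
        next
          case False
          \<comment> \<open>Off the segments both values come from cells. If the cell is the same,
            injectivity gives a common preimage, and the pair is the image of a pair over it;
            different cells touch only at images of vertices, where \<open>vertex\<close> and
            \<open>glue\<close> make the values equal.\<close>
          obtain k a b where k: "k \<in> S" "(a, b) \<in> M" "x = G p \<beta> k a" "y = f k b"
            using M_cases[OF w(2)] False by blast
          obtain l a' b' where l: "l \<in> S" "(a', b') \<in> M" "x = G p \<beta> l a'" "y' = f l b'"
            using M_cases[OF w(3)] False by blast
          show ?thesis
          proof (cases "k = l")
            case True
            then have "a = a'" using k l G_inj[OF \<beta>(2), of p l a a'] by simp
            then have "(b, b') \<in> ?D"
              using k l by (intro image_eqI[where x = "((a, b), (a', b'))"]) auto
            then show ?thesis using k(1,4) l(4) True w(1) by force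
          next
            case False
            have "a = p l" "a' = p k"
              using cells_meet[OF k(1) l(1) False M_T[OF k(2)] M_T[OF l(2)] \<beta>] k l by simp_all
            then have "b = q l" "b' = q k" using vertex k l by auto
            then show ?thesis using k l w glue by simp
          qed
        qed
      qed
    qed (use e in auto)
    have "(y, y') \<in> ?D"
      using that by (intro image_eqI[where x = "((x, y), (x, y'))"]) auto
    from subsetD[OF sub this] show ?thesis by simp
  qed
  define g where "g x = (THE y. (x, y) \<in> M)" for x
  have g_eqI: "g x = y" if "(x, y) \<in> M" for x y
    unfolding g_def using that unique by blast
  have g_in: "(x, g x) \<in> M" if "x \<in> X" for x
    using that g_eqI \<open>fst ` M = X\<close> by force
  have graph: "(\<lambda>x. (x, g x)) ` X = M"
    using g_in g_eqI \<open>fst ` M = X\<close> by force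
  show thesis
  proof
    \<comment> \<open>The graph is compact, hence closed, and all values lie in a compact
      set.\<close>
    show "continuous_on X g"
    proof (rule continuous_from_closed_graph)
      show "compact (snd ` M)"
        by (intro compact_continuous_image continuous_intros M(1))
      show "g \<in> X \<rightarrow> snd ` M" using g_in by force
      show "closed ((\<lambda>x. (x, g x)) ` X)" unfolding graph by (rule compact_imp_closed[OF M(1)])
    qed
    show "g (G p \<beta> i x) = f i (g x)" if "i \<in> S" "x \<in> X" for i x
      by (rule g_eqI[OF M_G[OF that(1) g_in[OF that(2)]]])
    show "g x = f i (q j)" if "(i, j) \<in> B" "x \<in> gseg \<beta> i j" for i j x
      by (rule g_eqI[OF M_seg[OF that]])
    show "g (p i) = q i" if "i \<in> S" for i
    proof -
      have "p i \<in> X"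
        by (rule p_in_attractor[OF _ _ gasket_G[OF X] that \<beta>]) (use X in \<open>auto simp: is_gasket_def\<close>)
      then show ?thesis using vertex[OF that] g_in by auto
    qed
  qed
qed

end


section \<open>The projection onto the Sierpinski gasket\<close>

lemma comp_word_affine:
  fixes f :: "nat \<Rightarrow> 'a::real_vector \<Rightarrow> 'a"
  assumes "\<And>i a b. f i ((1 - t) *\<^sub>R a + t *\<^sub>R b) = (1 - t) *\<^sub>R f i a + t *\<^sub>R f i b"
  shows "comp_word f w ((1 - t) *\<^sub>R a + t *\<^sub>R b) = (1 - t) *\<^sub>R comp_word f w a + t *\<^sub>R comp_word f w b"
  by (induction w) (simp_all add: assms)

lemma G_affine: "G p \<beta> i ((1 - t) *\<^sub>R a + t *\<^sub>R b) = (1 - t) *\<^sub>R G p \<beta> i a + t *\<^sub>R G p \<beta> i b"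
proof -
  define c where "c = (1 - \<beta>) / 2"
  have "c *\<^sub>R ((1 - t) *\<^sub>R a + t *\<^sub>R b - p i) + p i
      = (1 - t) *\<^sub>R (c *\<^sub>R (a - p i) + p i) + t *\<^sub>R (c *\<^sub>R (b - p i) + p i)"
    by (simp add: algebra_simps)
  then show ?thesis by (simp add: G_def c_def)
qed

lemma mem_edge_word:
  assumes "i \<in> S" "j \<in> S" "set w \<subseteq> S"
  shows "edge_word w i j \<in> infinite_words"
  using assms by (auto simp: infinite_words_def edge_word_def)

lemma map_edge_word_le: "m \<le> length w \<Longrightarrow> map (edge_word w i j) [0..<m] = take m w"
  by (rule nth_equalityI) (auto simp: edge_word_def)

lemma map_edge_word_gt:
  "map (edge_word w i j) [0..<length w + 1 + k] = w @ i # replicate k j"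
  by (rule nth_equalityI) (auto simp: edge_word_def nth_append nth_Cons split: nat.splits)

context triangle
begin

lemma G0_glue: "G p 0 i (p j) = G p 0 j (p i)"
  by (simp add: G_def vec_eq_iff field_simps)

lemma F_glue: "F p i (p j) = F p j (p i)"
  unfolding F_eq_G by (rule G0_glue)

lemma F_fixed: "F p i (p i) = p i"
  by (simp add: F_eq_G)

lemma dist_F_le: "dist (F p i x) (F p i y) \<le> 1/2 * dist x y"
  using dist_G_le[of 0] by (simp add: F_eq_G)

lemma gasket_exists:
  assumes "\<beta> < 1" "0 \<le> \<beta>"
  shows "\<exists>X. is_gasket \<beta> X"
  unfolding is_gasket_def
  by (rule ifs_attractor_exists[OF finite_S S_nonempty, of "(1 - \<beta>) / 2"])
     (use assms dist_G_le in \<open>auto simp: gseg_def\<close>)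

lemma K_is_gasket:
  assumes "\<beta> < 1" "0 \<le> \<beta>"
  shows "is_gasket \<beta> (K p \<beta>)"
proof -
  obtain X where X: "is_gasket \<beta> X" using gasket_exists[OF assms] by blast
  have edge: "edge p \<beta> [] i j = gseg \<beta> i j" for i j
    by (auto simp: edge_conv_gseg)
  have "K p \<beta> = X"
    unfolding K_def edge
  proof (rule the_equality)
    fix Y assume Y: "compact Y \<and> Y = (\<Union>i\<in>S. G p \<beta> i ` Y) \<union> (\<Union>(i, j)\<in>B. gseg \<beta> i j)"
    \<comment> \<open>The definition of \<open>K\<close> does not ask for a nonempty set; the
      segments exclude the empty solution.\<close>
    have "gseg \<beta> 1 2 \<noteq> {}" "(1, 2) \<in> B" by (simp_all add: gseg_def B_def)
    then have "Y \<noteq> {}" using Y by fast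
    then show "Y = X"
      using X Y assms dist_G_le unfolding is_gasket_def
      by (intro ifs_attractor_unique[of "(1 - \<beta>) / 2" S "G p \<beta>" Y "\<Union>(i, j)\<in>B. gseg \<beta> i j" X]) auto
  qed (use X in \<open>auto simp: is_gasket_def\<close>)
  then show ?thesis using X by simp
qed

text \<open>Covers \<open>Sigma_set\<close> with \<beta> = \<alpha> and \<open>K_star\<close> with
  \<beta> = 0.\<close>

lemma attractor_the:
  assumes "\<beta> < 1" "0 \<le> \<beta>"
  defines "X \<equiv> THE X. compact X \<and> X \<noteq> {} \<and> X = (\<Union>i\<in>S. G p \<beta> i ` X)"
  shows "compact X \<and> X \<noteq> {} \<and> X = (\<Union>i\<in>S. G p \<beta> i ` X)"
proof -
  have c: "0 < (1 - \<beta>) / 2" "(1 - \<beta>) / 2 < 1" using assms by auto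
  have "\<exists>X. compact X \<and> X \<noteq> {} \<and> X = (\<Union>i\<in>S. G p \<beta> i ` X) \<union> {}"
    by (rule ifs_attractor_exists[OF finite_S S_nonempty c]) (use assms dist_G_le in auto)
  then obtain Y where Y: "compact Y \<and> Y \<noteq> {} \<and> Y = (\<Union>i\<in>S. G p \<beta> i ` Y)" by auto
  show ?thesis
    unfolding X_def
  proof (rule theI[of _ Y])
    show "Z = Y" if "compact Z \<and> Z \<noteq> {} \<and> Z = (\<Union>i\<in>S. G p \<beta> i ` Z)" for Z
      using ifs_attractor_unique[OF c, of S "G p \<beta>" Z "{}" Y] that Y dist_G_le[OF assms(1)] by simp
  qed (rule Y)
qed

text \<open>Adding the segments changes nothing here: each is the single point
  \<open>G p 0 i (p j)\<close>, the image of a vertex of the attractor.\<close>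

lemma K_star_is_gasket: "is_gasket 0 (K_star p)"
proof -
  have *: "compact (K_star p)" "K_star p \<noteq> {}" "K_star p = (\<Union>i\<in>S. G p 0 i ` K_star p)"
    using attractor_the[of 0] by (simp_all add: K_star_def F_eq_G)
  have G: "G p 0 i ` K_star p \<subseteq> K_star p" if "i \<in> S" for i
    using *(3) that by blast
  have "gseg 0 i j \<subseteq> K_star p" if "(i, j) \<in> B" for i j
  proof -
    have "i \<in> S" "j \<in> S" using B_D[OF that] by auto
    then have "p j \<in> K_star p" by (intro p_in_attractor[OF *(1,2) G]) auto
    then show ?thesis using G[OF \<open>i \<in> S\<close>] by (auto simp: gseg_def G0_glue[of j i])
  qed
  then have "(\<Union>(i, j)\<in>B. gseg 0 i j) \<subseteq> K_star p" by blast
  then have "K_star p = (\<Union>i\<in>S. G p 0 i ` K_star p) \<union> (\<Union>(i, j)\<in>B. gseg 0 i j)"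
    using *(3) by blast
  then show ?thesis unfolding is_gasket_def using *(1,2) by blast
qed

lemma F_K_star: "i \<in> S \<Longrightarrow> F p i ` K_star p \<subseteq> K_star p"
  using gasket_G[OF K_star_is_gasket] by (simp add: F_eq_G)

lemma K_star_eq: "K_star p = (\<Union>i\<in>S. F p i ` K_star p)"
  using attractor_the[of 0] by (simp add: K_star_def F_eq_G)

lemma p_in_K_star: "i \<in> S \<Longrightarrow> p i \<in> K_star p"
  using K_star_is_gasket gasket_G[OF K_star_is_gasket]
  by (intro p_in_attractor[where X = "K_star p" and \<beta> = 0]) (auto simp: is_gasket_def)

lemma pi_word_eqI:
  assumes "\<omega> \<in> infinite_words" "\<And>m. y \<in> comp_word (F p) (map \<omega> [0..<m]) ` K_star p"
  shows "pi_word p \<omega> = y"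
proof -
  have "cylinders (F p) (K_star p) \<omega> = {y}"
    by (rule cylinders_singleton[of \<omega> "1/2"])
       (use assms dist_F_le K_star_is_gasket in \<open>auto simp: is_gasket_def\<close>)
  then show ?thesis by (simp add: pi_word_def)
qed

text \<open>Since \<open>F p j\<close> fixes \<open>p j\<close>, this vertex witnesses membership in
  every cylinder reaching beyond \<open>w\<close>. For shorter prefixes the remaining letters keep
  the point inside \<open>K_star p\<close>.\<close>

lemma pi_word_edge_word:
  assumes w: "set w \<subseteq> S" and ij: "i \<in> S" "j \<in> S"
  shows "pi_word p (edge_word w i j) = comp_word (F p) w (F p i (p j))"
proof (rule pi_word_eqI[OF mem_edge_word[OF ij w]])
  fix m
  show "comp_word (F p) w (F p i (p j)) \<in> comp_word (F p) (map (edge_word w i j) [0..<m]) ` K_star p"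
  proof (cases "m \<le> length w")
    case True
    have "comp_word (F p) w (F p i (p j))
        = comp_word (F p) (take m w) (comp_word (F p) (drop m w) (F p i (p j)))"
      by (simp flip: comp_word_append)
    moreover have "comp_word (F p) (drop m w) (F p i (p j)) \<in> K_star p"
      using w F_K_star p_in_K_star[OF ij(2)] ij
      by (intro comp_word_invariant[of _ S]) (auto dest: in_set_dropD)
    ultimately show ?thesis using True by (simp add: map_edge_word_le)
  next
    case False
    then obtain k where k: "m = length w + 1 + k"
      using le_Suc_ex[of "length w + 1" m] by force
    have "comp_word (F p) (replicate k j) (p j) = p j"
      by (induction k) (simp_all add: F_eq_G)
    then show ?thesis
      using p_in_K_star[OF ij(2)] unfolding k map_edge_word_gt
      by (intro image_eqI[of _ _ "p j"]) (simp_all add: comp_word_append)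
  qed
qed

end

section \<open>The stretched gasket, its addresses and its projection\<close>

locale stretched = triangle +
  fixes \<alpha> :: real
  assumes \<alpha>: "0 < \<alpha>" "\<alpha> < 1"
begin

lemma K_gasket: "is_gasket \<alpha> (K p \<alpha>)"
  using \<alpha> by (intro K_is_gasket) auto

lemma compact_K: "compact (K p \<alpha>)" and K_nonempty: "K p \<alpha> \<noteq> {}"
  using K_gasket by (auto simp: is_gasket_def)

lemma G_K: "i \<in> S \<Longrightarrow> G p \<alpha> i ` K p \<alpha> \<subseteq> K p \<alpha>"
  by (rule gasket_G[OF K_gasket])

lemma p_in_K: "i \<in> S \<Longrightarrow> p i \<in> K p \<alpha>"
  using \<alpha> by (intro p_in_attractor[OF compact_K K_nonempty G_K]) auto

lemma comp_word_in_K: "set w \<subseteq> S \<Longrightarrow> x \<in> K p \<alpha> \<Longrightarrow> comp_word (G p \<alpha>) w x \<in> K p \<alpha>"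
  by (rule comp_word_invariant[of w S]) (use G_K in auto)

lemma edge_subset_K: "set w \<subseteq> S \<Longrightarrow> (i, j) \<in> B \<Longrightarrow> edge p \<alpha> w i j \<subseteq> K p \<alpha>"
  using gasket_gseg[OF K_gasket] comp_word_in_K by (fastforce simp: edge_conv_gseg)

lemma Sigma_attractor:
  "compact (Sigma_set p \<alpha>)" "Sigma_set p \<alpha> \<noteq> {}" "Sigma_set p \<alpha> = (\<Union>i\<in>S. G p \<alpha> i ` Sigma_set p \<alpha>)"
  using attractor_the[of \<alpha>] \<alpha> by (simp_all add: Sigma_set_def)

lemma Sigma_subset_K: "Sigma_set p \<alpha> \<subseteq> K p \<alpha>"
proof (rule ifs_subset[where f = "G p \<alpha>" and I = S and c = "(1 - \<alpha>) / 2"])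
  show "Sigma_set p \<alpha> \<subseteq> K p \<alpha> \<union> (\<Union>i\<in>S. G p \<alpha> i ` Sigma_set p \<alpha>)"
    using Sigma_attractor(3) by blast
qed (use \<alpha> compact_K K_nonempty G_K dist_G_le Sigma_attractor(1) in \<open>auto intro: compact_imp_closed\<close>)

text \<open>A point of \<open>K\<close> on no edge lies in some cell, and its preimage is on no edge
  either. So the set \<open>Z\<close> of such points is contained in the union of its images; its
  closure inherits this and, being compact, lies in \<open>Sigma_set\<close> by
  \<open>ifs_subset\<close>.\<close>

lemma K_decomposition:
  assumes "x \<in> K p \<alpha>" "x \<notin> Sigma_set p \<alpha>"
  shows "\<exists>w\<in>W_star. \<exists>(i, j)\<in>B. x \<in> edge p \<alpha> w i j"
proof (rule ccontr)
  assume not_edge: "\<not> ?thesis"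
  define N where "N = (\<Union>w\<in>W_star. \<Union>(i, j)\<in>B. edge p \<alpha> w i j)"
  have N_I: "x \<in> N" if "w \<in> W_star" "(i, j) \<in> B" "x \<in> edge p \<alpha> w i j" for w i j x
    unfolding N_def using that by force
  define Z where "Z = K p \<alpha> - N"
  have Z: "Z \<subseteq> (\<Union>i\<in>S. G p \<alpha> i ` Z)"
  proof
    fix x assume x: "x \<in> Z"
    have "x \<notin> gseg \<alpha> i j" if "(i, j) \<in> B" for i j
    proof -
      have "x \<notin> edge p \<alpha> [] i j"
        using x N_I[of "[]" i j x] that by (auto simp: Z_def W_star_def W_def)
      then show ?thesis by (simp add: edge_conv_gseg image_iff)
    qed
    moreover have "x \<in> (\<Union>i\<in>S. G p \<alpha> i ` K p \<alpha>) \<union> (\<Union>(i, j)\<in>B. gseg \<alpha> i j)"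
      using x K_gasket unfolding is_gasket_def Z_def by blast
    ultimately obtain i y where i: "i \<in> S" "y \<in> K p \<alpha>" "x = G p \<alpha> i y" by blast
    have "y \<notin> N"
    proof
      assume "y \<in> N"
      then obtain w j k where w: "w \<in> W_star" "(j, k) \<in> B" "y \<in> edge p \<alpha> w j k"
        by (auto simp: N_def)
      then have "i # w \<in> W_star" "x \<in> edge p \<alpha> (i # w) j k"
        using i by (auto simp: W_star_def W_def edge_def)
      then have "x \<in> N" using w(2) by (intro N_I)
      then show False using x by (simp add: Z_def)
    qed
    then show "x \<in> (\<Union>i\<in>S. G p \<alpha> i ` Z)" using i by (auto simp: Z_def)
  qed
  have ZK: "closure Z \<subseteq> K p \<alpha>"
    using compact_K by (intro closure_minimal compact_imp_closed) (auto simp: Z_def)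
  have comp: "compact (closure Z)"
    using compact_K ZK by (metis closed_closure compact_Int_closed inf.absorb2)
  have "closed (\<Union>i\<in>S. G p \<alpha> i ` closure Z)"
    using \<alpha> by (intro compact_imp_closed compact_UN finite_S compact_continuous_image comp
        contraction_continuous_on[OF dist_G_le]) auto
  then have "closure Z \<subseteq> (\<Union>i\<in>S. G p \<alpha> i ` closure Z)"
    using Z closure_subset[of Z] by (intro closure_minimal) blast+
  then have sub: "closure Z \<subseteq> Sigma_set p \<alpha> \<union> (\<Union>i\<in>S. G p \<alpha> i ` closure Z)" by blast
  have inv: "G p \<alpha> i ` Sigma_set p \<alpha> \<subseteq> Sigma_set p \<alpha>" if "i \<in> S" for i
    using that Sigma_attractor(3) by blast
  have "closure Z \<subseteq> Sigma_set p \<alpha>"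
    by (rule ifs_subset[OF comp compact_imp_closed[OF Sigma_attractor(1)] Sigma_attractor(2)
          _ _ dist_G_le[OF \<alpha>(2)] inv sub]) (use \<alpha> in auto)
  moreover have "x \<in> Z" using assms(1) not_edge by (auto simp: Z_def N_def)
  ultimately show False using assms(2) closure_subset by blast
qed

text \<open>At the first differing letter the common prefix cancels by injectivity, leaving two
  distinct cells with a common point; this happens only for \<beta> = 0, whereas \<alpha> is
  positive.\<close>

lemma address_unique:
  assumes \<omega>: "\<omega> \<in> infinite_words" "\<And>m. x \<in> comp_word (G p \<alpha>) (map \<omega> [0..<m]) ` Sigma_set p \<alpha>"
    and \<omega>': "\<omega>' \<in> infinite_words" "\<And>m. x \<in> comp_word (G p \<alpha>) (map \<omega>' [0..<m]) ` Sigma_set p \<alpha>"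
  shows "\<omega> = \<omega>'"
proof
  fix n
  show "\<omega> n = \<omega>' n"
  proof (induction n rule: less_induct)
    case (less n)
    define w where "w = map \<omega> [0..<n]"
    have w': "map \<omega>' [0..<n] = w" using less by (auto simp: w_def)
    obtain y where y: "y \<in> Sigma_set p \<alpha>" "x = comp_word (G p \<alpha>) w (G p \<alpha> (\<omega> n) y)"
      using \<omega>(2)[of "Suc n"] by (auto simp: comp_word_append w_def)
    obtain y' where y': "y' \<in> Sigma_set p \<alpha>" "x = comp_word (G p \<alpha>) w (G p \<alpha> (\<omega>' n) y')"
      using \<omega>'(2)[of "Suc n"] by (auto simp: comp_word_append w')
    have inj: "comp_word (G p \<alpha>) v a = comp_word (G p \<alpha>) v b \<Longrightarrow> a = b" for v a b
      by (induction v) (auto simp: G_inj[OF \<alpha>(2)])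
    have T: "Sigma_set p \<alpha> \<subseteq> T"
      using Sigma_subset_K gasket_subset_T[OF K_gasket] \<alpha> by auto
    have eq: "G p \<alpha> (\<omega> n) y = G p \<alpha> (\<omega>' n) y'"
      using inj[of w] y(2) y'(2) by simp
    have mem: "\<omega> n \<in> S" "\<omega>' n \<in> S" "y \<in> T" "y' \<in> T" "0 \<le> \<alpha>"
      using \<omega>(1) \<omega>'(1) y(1) y'(1) T \<alpha> by (auto simp: infinite_words_def)
    show ?case
    proof (rule ccontr)
      assume "\<omega> n \<noteq> \<omega>' n"
      from cells_meet(3)[OF mem(1,2) this mem(3-5) \<alpha>(2) eq] show False using \<alpha> by simp
    qed
  qed
qed

lemma address_Sigma:
  assumes x: "x \<in> Sigma_set p \<alpha>"
  shows "address p \<alpha> x \<in> infinite_words"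
    "x \<in> comp_word (G p \<alpha>) (map (address p \<alpha> x) [0..<m]) ` Sigma_set p \<alpha>"
proof -
  obtain \<omega> where \<omega>: "\<omega> \<in> infinite_words"
    "\<And>m. x \<in> comp_word (G p \<alpha>) (map \<omega> [0..<m]) ` Sigma_set p \<alpha>"
    using ifs_address_exists[OF Sigma_attractor(3) x] by blast
  have "address p \<alpha> x = \<omega>"
    unfolding address_def
  proof (rule the_equality)
    have "cylinders (G p \<alpha>) (Sigma_set p \<alpha>) \<omega> = {x}"
      by (rule cylinders_singleton[OF \<omega>(1), of "(1 - \<alpha>) / 2"])
         (use \<alpha> dist_G_le Sigma_attractor(1) \<omega>(2) in auto)
    then show "\<omega> \<in> infinite_words \<and> cylinders (G p \<alpha>) (Sigma_set p \<alpha>) \<omega> = {x}"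
      using \<omega>(1) by simp
    fix \<omega>' assume \<omega>': "\<omega>' \<in> infinite_words \<and> cylinders (G p \<alpha>) (Sigma_set p \<alpha>) \<omega>' = {x}"
    then have "x \<in> cylinders (G p \<alpha>) (Sigma_set p \<alpha>) \<omega>'" by simp
    then have "x \<in> comp_word (G p \<alpha>) (map \<omega>' [0..<m]) ` Sigma_set p \<alpha>" for m
      unfolding cylinders_def by blast
    then show "\<omega>' = \<omega>" using address_unique \<omega> \<omega>' by blast
  qed
  then show "address p \<alpha> x \<in> infinite_words"
    "x \<in> comp_word (G p \<alpha>) (map (address p \<alpha> x) [0..<m]) ` Sigma_set p \<alpha>"
    using \<omega> by auto
qed

text \<open>All five facts hold for the semiconjugacy \<open>g\<close> from \<open>G\<close> to
  \<open>F\<close> with \<open>q = p\<close>, and \<open>pi_star\<close> agrees with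
  \<open>g\<close> on \<open>K\<close>: over \<open>Sigma_set\<close> the point \<open>g x\<close>
  lies in every cylinder of the address of \<open>x\<close>, and on an edge \<open>g\<close> takes
  the prescribed constant.\<close>

lemma pi_star_properties:
  shows pi_star_cont: "continuous_on (K p \<alpha>) (pi_star p \<alpha>)"
    and pi_star_G: "i \<in> S \<Longrightarrow> x \<in> K p \<alpha> \<Longrightarrow> pi_star p \<alpha> (G p \<alpha> i x) = F p i (pi_star p \<alpha> x)"
    and pi_star_gseg: "(i, j) \<in> B \<Longrightarrow> x \<in> gseg \<alpha> i j \<Longrightarrow> pi_star p \<alpha> x = F p i (p j)"
    and pi_star_p: "i \<in> S \<Longrightarrow> pi_star p \<alpha> (p i) = p i"
    and pi_star_K: "x \<in> K p \<alpha> \<Longrightarrow> pi_star p \<alpha> x \<in> K_star p"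
proof -
  have c: "0 \<le> \<alpha>" "0 < (1/2 :: real)" "1/2 < (1 :: real)" using \<alpha> by auto
  obtain g where cont: "continuous_on (K p \<alpha>) g"
    and g_G: "\<And>i x. i \<in> S \<Longrightarrow> x \<in> K p \<alpha> \<Longrightarrow> g (G p \<alpha> i x) = F p i (g x)"
    and g_seg: "\<And>i j x. (i, j) \<in> B \<Longrightarrow> x \<in> gseg \<alpha> i j \<Longrightarrow> g x = F p i (p j)"
    and g_p: "\<And>i. i \<in> S \<Longrightarrow> g (p i) = p i"
    by (rule gasket_semiconjugacy[where f = "F p" and q = p,
          OF K_gasket c(1) \<alpha>(2) c(2,3) dist_F_le F_fixed F_glue]) (rule that)
  \<comment> \<open>Values in \<open>K_star\<close> are needed to place \<open>g x\<close> in the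
    cylinders that define \<open>pi_word\<close>.\<close>
  have g_K: "g ` K p \<alpha> \<subseteq> K_star p"
  proof (rule ifs_subset[where f = "F p" and I = S and c = "1/2"])
    show "compact (g ` K p \<alpha>)" by (rule compact_continuous_image[OF cont compact_K])
    show "g ` K p \<alpha> \<subseteq> K_star p \<union> (\<Union>i\<in>S. F p i ` g ` K p \<alpha>)"
    proof
      fix y assume "y \<in> g ` K p \<alpha>"
      then obtain x where x: "x \<in> K p \<alpha>" "y = g x" by blast
      then consider i x' where "i \<in> S" "x' \<in> K p \<alpha>" "x = G p \<alpha> i x'"
        | i j where "(i, j) \<in> B" "x \<in> gseg \<alpha> i j"
        using K_gasket unfolding is_gasket_def by blast
      then show "y \<in> K_star p \<union> (\<Union>i\<in>S. F p i ` g ` K p \<alpha>)"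
      proof cases
        case 1
        then have "y = F p i (g x')" using x g_G by simp
        then show ?thesis using 1 by blast
      next
        case 2
        then have "y = F p i (p j)" using x g_seg by simp
        then show ?thesis using F_K_star p_in_K_star B_D[OF 2(1)] by blast
      qed
    qed
  qed (use dist_F_le F_K_star K_star_is_gasket in \<open>auto simp: is_gasket_def intro: compact_imp_closed\<close>)
  have g_word: "g (comp_word (G p \<alpha>) w x) = comp_word (F p) w (g x)"
    if "set w \<subseteq> S" "x \<in> K p \<alpha>" for w x
    by (rule comp_word_semiconj[where g = g and h = "F p", OF that(1) G_K g_G that(2)])
  have pi: "pi_star p \<alpha> x = g x" if x: "x \<in> K p \<alpha>" for x
  proof (cases "x \<in> Sigma_set p \<alpha>")
    case True
    have "pi_word p (address p \<alpha> x) = g x"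
    proof (rule pi_word_eqI[OF address_Sigma(1)[OF True]])
      fix m
      let ?w = "map (address p \<alpha> x) [0..<m]"
      obtain z where z: "z \<in> Sigma_set p \<alpha>" "x = comp_word (G p \<alpha>) ?w z"
        using address_Sigma(2)[OF True, of m] by blast
      then have "z \<in> K p \<alpha>" using Sigma_subset_K by blast
      have "g x = comp_word (F p) ?w (g z)"
        by (subst z(2)) (rule g_word[OF set_prefix_infinite_word[OF address_Sigma(1)[OF True]] \<open>z \<in> K p \<alpha>\<close>])
      then show "g x \<in> comp_word (F p) ?w ` K_star p"
        using g_K \<open>z \<in> K p \<alpha>\<close> by blast
    qed
    then show ?thesis using True by (simp add: pi_star_def)
  next
    case False
    \<comment> \<open>Whichever edge contains \<open>x\<close>, the value prescribed there is
      \<open>g x\<close>; this settles the definite description.\<close>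
    have *: "pi_word p (edge_word w i j) = g x"
      if "w \<in> W_star" "(i, j) \<in> B" "x \<in> edge p \<alpha> w i j" for w i j
    proof -
      note mem = that
      have w: "set w \<subseteq> S" using mem(1) by (auto simp: W_star_def W_def)
      obtain z where z: "z \<in> gseg \<alpha> i j" "x = comp_word (G p \<alpha>) w z"
        using mem(3) by (auto simp: edge_conv_gseg)
      have "g x = comp_word (F p) w (g z)"
        unfolding z(2) using w z gasket_gseg[OF K_gasket mem(2)] by (intro g_word) auto
      then show ?thesis
        using pi_word_edge_word[OF w] B_D[OF mem(2)] g_seg[OF mem(2) z(1)] by simp
    qed
    obtain w i j where "w \<in> W_star" "(i, j) \<in> B" "x \<in> edge p \<alpha> w i j"
      using K_decomposition[OF x False] by blast
    then have "\<exists>w\<in>W_star. \<exists>(i, j)\<in>B. x \<in> edge p \<alpha> w i j \<and> g x = pi_word p (edge_word w i j)"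
      using *[symmetric] by blast
    then have "(THE y. \<exists>w\<in>W_star. \<exists>(i, j)\<in>B. x \<in> edge p \<alpha> w i j \<and> y = pi_word p (edge_word w i j)) = g x"
      using * by (intro the_equality) auto
    then show ?thesis using False by (simp add: pi_star_def)
  qed
  show "continuous_on (K p \<alpha>) (pi_star p \<alpha>)"
    using cont by (rule continuous_on_eq) (simp add: pi)
  show "i \<in> S \<Longrightarrow> x \<in> K p \<alpha> \<Longrightarrow> pi_star p \<alpha> (G p \<alpha> i x) = F p i (pi_star p \<alpha> x)"
    using G_K g_G by (subst (1 2) pi) auto
  show "(i, j) \<in> B \<Longrightarrow> x \<in> gseg \<alpha> i j \<Longrightarrow> pi_star p \<alpha> x = F p i (p j)"
    using gasket_gseg[OF K_gasket] g_seg by (subst pi) auto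
  show "i \<in> S \<Longrightarrow> pi_star p \<alpha> (p i) = p i"
    using g_p p_in_K by (subst pi) auto
  show "x \<in> K p \<alpha> \<Longrightarrow> pi_star p \<alpha> x \<in> K_star p"
    using g_K by (subst pi) auto
qed

lemma pi_star_comp_word:
  assumes "set w \<subseteq> S" "x \<in> K p \<alpha>"
  shows "pi_star p \<alpha> (comp_word (G p \<alpha>) w x) = comp_word (F p) w (pi_star p \<alpha> x)"
  by (rule comp_word_semiconj[where g = "pi_star p \<alpha>" and h = "F p", OF assms(1) G_K pi_star_G assms(2)])

lemma pi_star_edge:
  assumes "set w \<subseteq> S" "(i, j) \<in> B" "x \<in> edge p \<alpha> w i j"
  shows "pi_star p \<alpha> x = comp_word (F p) w (F p i (p j))"
proof -
  obtain z where z: "z \<in> gseg \<alpha> i j" "x = comp_word (G p \<alpha>) w z"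
    using assms(3) by (auto simp: edge_conv_gseg)
  then show ?thesis
    using pi_star_comp_word[OF assms(1)] gasket_gseg[OF K_gasket assms(2)] pi_star_gseg[OF assms(2)] by auto
qed

lemma closed_segment_edge_end:
  "closed_segment (edge_end p \<alpha> w i j) (edge_end p \<alpha> w j i) = edge p \<alpha> w i j"
  unfolding edge_conv_gseg gseg_def edge_end_def closed_segment_image_interval image_image
  by (simp add: comp_word_affine[where f = "G p \<alpha>", OF G_affine])

end


section \<open>Energies on the Sierpinski gasket\<close>

lemma finite_W: "finite (W m)"
  unfolding W_def by (rule finite_lists_length_eq) simp

text \<open>The last letter is split off, not the first, because appending a letter subdivides the
  cell of \<open>w\<close>.\<close>

lemma sum_W_Suc: "(\<Sum>w\<in>W (Suc m). f w) = (\<Sum>w\<in>W m. \<Sum>i\<in>S. f (w @ [i]))"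
proof -
  have W: "W (Suc m) = (\<lambda>(w, i). w @ [i]) ` (W m \<times> S)"
  proof (intro set_eqI iffI)
    fix w assume "w \<in> W (Suc m)"
    then show "w \<in> (\<lambda>(w, i). w @ [i]) ` (W m \<times> S)"
      by (cases w rule: rev_cases) (auto simp: W_def)
  qed (auto simp: W_def)
  have "inj_on (\<lambda>(w, i). w @ [i]) (W m \<times> S)"
    by (auto simp: inj_on_def)
  then show ?thesis
    unfolding W by (subst sum.reindex) (auto simp: sum.cartesian_product case_prod_unfold)
qed

lemma comp_word_snoc: "v \<circ> comp_word f (w @ [i]) = (v \<circ> comp_word f w) \<circ> f i"
  by (auto simp: comp_word_append)

text \<open>The remainder is the energy of the deviation of the three midpoint values \<open>x\<close>, \<open>y\<close>, \<open>z\<close>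
  from the harmonic extension of \<open>a\<close>, \<open>b\<close>, \<open>c\<close>.\<close>

lemma harmonic_extension_identity:
  fixes a b c x y z :: real
  defines "x' \<equiv> x - (2 * a + 2 * b + c) / 5" and "y' \<equiv> y - (2 * b + 2 * c + a) / 5"
    and "z' \<equiv> z - (2 * c + 2 * a + b) / 5"
  shows "5/3 * (((a - x)\<^sup>2 + (x - z)\<^sup>2 + (z - a)\<^sup>2) + ((x - b)\<^sup>2 + (b - y)\<^sup>2 + (y - x)\<^sup>2)
        + ((z - y)\<^sup>2 + (y - c)\<^sup>2 + (c - z)\<^sup>2))
    = ((a - b)\<^sup>2 + (b - c)\<^sup>2 + (c - a)\<^sup>2)
        + 5/3 * ((x' - y')\<^sup>2 + (y' - z')\<^sup>2 + (z' - x')\<^sup>2 + 2 * (x'\<^sup>2 + y'\<^sup>2 + z'\<^sup>2))"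
  unfolding x'_def y'_def z'_def by (simp add: power2_eq_square field_simps)

lemma Q0_eq: "Q0 p u u = (u (p 1) - u (p 2))\<^sup>2 + (u (p 2) - u (p 3))\<^sup>2 + (u (p 3) - u (p 1))\<^sup>2"
  by (simp add: Q0_def B_def power2_eq_square)

lemma Q0_eq_0D:
  assumes "Q0 p u u = 0" "i \<in> S"
  shows "u (p i) = u (p 1)"
proof -
  have "a = 0 \<and> c = 0" if "a\<^sup>2 + b\<^sup>2 + c\<^sup>2 = 0" for a b c :: real
    using that by (smt (verit) zero_le_power2 power_eq_0_iff)
  from this[OF assms(1)[unfolded Q0_eq]] have "u (p 1) = u (p 2)" "u (p 3) = u (p 1)" by auto
  then show ?thesis using assms(2) by (auto simp: S_def)
qed

lemma Q0_nonneg: "0 \<le> Q0 p u u"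
  by (simp add: Q0_eq)

text \<open>The sequence whose boundedness defines \<open>F_star\<close>; the factor 5/3 is the one
  that makes harmonic extension preserve energy.\<close>

definition energy :: "(nat \<Rightarrow> real^2) \<Rightarrow> nat \<Rightarrow> (real^2 \<Rightarrow> real) \<Rightarrow> real" where
  "energy p m v = (5/3)^m * (\<Sum>w\<in>W m. Q0 p (v \<circ> comp_word (F p) w) (v \<circ> comp_word (F p) w))"

lemma energy_nonneg: "0 \<le> energy p m v"
  unfolding energy_def by (intro mult_nonneg_nonneg sum_nonneg Q0_nonneg) auto

lemma energy_Suc:
  "energy p (Suc m) v
    = (5/3)^m * (\<Sum>w\<in>W m. 5/3 * (\<Sum>i\<in>S. Q0 p (v \<circ> comp_word (F p) w \<circ> F p i) (v \<circ> comp_word (F p) w \<circ> F p i)))"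
  unfolding energy_def sum_W_Suc comp_word_snoc by (simp add: sum_distrib_left mult_ac)

context triangle
begin

lemma Q0_refine:
  fixes u :: "real^2 \<Rightarrow> real"
  defines "x' \<equiv> u (F p 1 (p 2)) - (2 * u (p 1) + 2 * u (p 2) + u (p 3)) / 5"
    and "y' \<equiv> u (F p 2 (p 3)) - (2 * u (p 2) + 2 * u (p 3) + u (p 1)) / 5"
    and "z' \<equiv> u (F p 3 (p 1)) - (2 * u (p 3) + 2 * u (p 1) + u (p 2)) / 5"
  shows "5/3 * (\<Sum>i\<in>S. Q0 p (u \<circ> F p i) (u \<circ> F p i))
    = Q0 p u u + 5/3 * ((x' - y')\<^sup>2 + (y' - z')\<^sup>2 + (z' - x')\<^sup>2 + 2 * (x'\<^sup>2 + y'\<^sup>2 + z'\<^sup>2))"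
proof -
  have "(\<Sum>i\<in>S. Q0 p (u \<circ> F p i) (u \<circ> F p i))
      = Q0 p (u \<circ> F p 1) (u \<circ> F p 1) + Q0 p (u \<circ> F p 2) (u \<circ> F p 2) + Q0 p (u \<circ> F p 3) (u \<circ> F p 3)"
    by (simp add: S_def)
  then show ?thesis
    using harmonic_extension_identity[of "u (p 1)" "u (F p 1 (p 2))" "u (F p 3 (p 1))" "u (p 2)"
        "u (F p 2 (p 3))" "u (p 3)"]
    unfolding x'_def y'_def z'_def Q0_eq comp_def F_fixed F_glue[of 2 1] F_glue[of 1 3] F_glue[of 3 2]
    by simp
qed

lemma energy_mono: "incseq (\<lambda>m. energy p m v)"
proof (rule incseq_SucI)
  fix m
  have "Q0 p u u \<le> 5/3 * (\<Sum>i\<in>S. Q0 p (u \<circ> F p i) (u \<circ> F p i))" for u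
    unfolding Q0_refine by simp
  then show "energy p m v \<le> energy p (Suc m) v"
    unfolding energy_Suc unfolding energy_def by (intro mult_left_mono sum_mono) auto
qed

text \<open>Zero energy makes \<open>v\<close> constant on the vertices of each cell. As
  \<open>F p i\<close> fixes \<open>p i\<close>, the cells \<open>w\<close> and
  \<open>w @ [i]\<close> share a vertex, so all cells carry the same constant; their vertices are
  dense in \<open>K_star\<close>.\<close>

lemma energy_0_imp_const:
  assumes v: "continuous_on (K_star p) v" and zero: "\<And>m. energy p m v = 0" and x: "x \<in> K_star p"
  shows "v x = v (p 1)"
proof -
  have Q0: "Q0 p (v \<circ> comp_word (F p) w) (v \<circ> comp_word (F p) w) = 0" if "set w \<subseteq> S" for w
  proof -
    have "(\<Sum>w\<in>W (length w). Q0 p (v \<circ> comp_word (F p) w) (v \<circ> comp_word (F p) w)) = 0"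
      using zero[of "length w"] by (simp add: energy_def)
    then show ?thesis
      using that by (subst (asm) sum_nonneg_eq_0_iff[OF finite_W]) (auto simp: Q0_nonneg W_def)
  qed
  have vertices: "v (comp_word (F p) w (p i)) = v (comp_word (F p) w (p 1))"
    if "set w \<subseteq> S" "i \<in> S" for w i
    using Q0_eq_0D[OF Q0[OF that(1)] that(2)] by simp
  have const: "v (comp_word (F p) w (p 1)) = v (p 1)" if "set w \<subseteq> S" for w
    using that
  proof (induction w rule: rev_induct)
    case (snoc i w)
    have "v (comp_word (F p) (w @ [i]) (p 1)) = v (comp_word (F p) (w @ [i]) (p i))"
      using vertices[of "w @ [i]" i] snoc.prems by simp
    also have "\<dots> = v (comp_word (F p) w (p i))"
      by (simp add: comp_word_append F_fixed)
    also have "\<dots> = v (comp_word (F p) w (p 1))"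
      using vertices[of w i] snoc.prems by simp
    finally show ?case using snoc by simp
  qed simp
  obtain \<omega> where \<omega>: "\<omega> \<in> infinite_words" "\<And>m. x \<in> comp_word (F p) (map \<omega> [0..<m]) ` K_star p"
    using ifs_address_exists[OF K_star_eq x] by blast
  define y where "y m = comp_word (F p) (map \<omega> [0..<m]) (p 1)" for m
  have p1: "p 1 \<in> K_star p" by (rule p_in_K_star) (simp add: S_def)
  have y_K: "y m \<in> K_star p" for m
    unfolding y_def
    by (rule comp_word_invariant[OF set_prefix_infinite_word[OF \<omega>(1)] F_K_star p1])
  obtain b where b: "\<And>y z. y \<in> K_star p \<Longrightarrow> z \<in> K_star p \<Longrightarrow> dist y z \<le> b"
    using K_star_is_gasket compact_imp_bounded bounded_two_points unfolding is_gasket_def by metis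
  have dist: "dist (y m) x \<le> (1/2)^m * b" for m
  proof -
    obtain z where z: "z \<in> K_star p" "x = comp_word (F p) (map \<omega> [0..<m]) z"
      using \<omega>(2)[of m] by blast
    have "dist (y m) x \<le> (1/2)^length (map \<omega> [0..<m]) * dist (p 1) z"
      unfolding y_def z(2)
      by (rule comp_word_contraction[OF set_prefix_infinite_word[OF \<omega>(1)] _ dist_F_le]) simp
    also have "\<dots> \<le> (1/2)^m * b"
      using b[OF p1 z(1)] by simp
    finally show ?thesis .
  qed
  have "y \<longlonglongrightarrow> x"
  proof (rule metric_tendsto_imp_tendsto)
    have "(\<lambda>m. (1/2)^m * b) \<longlonglongrightarrow> 0 * b"
      by (intro tendsto_intros LIMSEQ_realpow_zero) auto
    then show "(\<lambda>m. (1/2)^m * b) \<longlonglongrightarrow> 0" by simp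
    show "\<forall>\<^sub>F m in sequentially. dist (y m) x \<le> dist ((1/2)^m * b) 0"
      using dist by (auto intro!: always_eventually order_trans[OF _ abs_ge_self])
  qed
  then have "(\<lambda>m. v (y m)) \<longlonglongrightarrow> v x"
    by (rule continuous_on_tendsto_compose[OF v _ x]) (simp add: y_K)
  moreover have "v (y m) = v (p 1)" for m
    unfolding y_def by (rule const[OF set_prefix_infinite_word[OF \<omega>(1)]])
  ultimately show ?thesis by (simp add: LIMSEQ_const_iff)
qed

text \<open>The affine map fixing \<open>p\<^sub>i\<close> that scales by \<open>3/5\<close> along \<open>p\<^sub>i\<close> and by \<open>1/5\<close> perpendicularly to it. It
  maps \<open>p\<^sub>j\<close> to \<open>(p\<^sub>i + p\<^sub>j)/5 = (2p\<^sub>i + 2p\<^sub>j + p\<^sub>k)/5\<close>, as the harmonic extension rule demands.\<close>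

definition harm :: "nat \<Rightarrow> real^2 \<Rightarrow> real^2" where
  "harm i y = p i + (1/5) *\<^sub>R (y - p i) + (6/5 * ((y - p i) \<bullet> p i)) *\<^sub>R p i"

lemma harm_vertex:
  assumes "i \<in> S" "j \<in> S"
  shows "harm i (p j) = (if i = j then p i else (1/5) *\<^sub>R (p i + p j))"
  using assms by (auto simp: harm_def inner_diff_left inner_p vec_eq_iff field_simps)

text \<open>The squared length of the image is 1/25 of that of \<open>d\<close> plus
  \<open>24/25 * s\<^sup>2\<close>. Cauchy-Schwarz with \<open>p i \<bullet> p i = 1/3\<close>
  bounds this by 1/25 + 8/25 = 9/25, the square of the larger factor 3/5.\<close>

lemma dist_harm_le:
  assumes "i \<in> S"
  shows "dist (harm i x) (harm i y) \<le> 3/5 * dist x y"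
proof (rule power2_le_imp_le)
  define d where "d = x - y"
  define s where "s = d \<bullet> p i"
  have eq: "harm i x - harm i y = (1/5) *\<^sub>R d + (6/5 * s) *\<^sub>R p i"
    by (simp add: harm_def d_def s_def inner_diff_left vec_eq_iff field_simps)
  have pi: "p i \<bullet> p i = 1/3" using inner_p[OF assms assms] by simp
  have "(dist (harm i x) (harm i y))\<^sup>2 = ((1/5) *\<^sub>R d + (6/5 * s) *\<^sub>R p i) \<bullet> ((1/5) *\<^sub>R d + (6/5 * s) *\<^sub>R p i)"
    by (simp add: dist_norm eq dot_square_norm)
  also have "\<dots> = 1/25 * (d \<bullet> d) + 24/25 * s\<^sup>2"
    by (simp add: inner_add_left inner_add_right pi s_def inner_commute[of "p i" d] power2_eq_square
        field_simps)
  also have "s\<^sup>2 \<le> (d \<bullet> d) * (p i \<bullet> p i)"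
    unfolding s_def by (rule Cauchy_Schwarz_ineq)
  also have "1/25 * (d \<bullet> d) + 24/25 * ((d \<bullet> d) * (p i \<bullet> p i)) = (3/5 * dist x y)\<^sup>2"
    unfolding pi by (simp add: d_def dist_norm dot_square_norm power_mult_distrib power2_eq_square)
  finally show "(dist (harm i x) (harm i y))\<^sup>2 \<le> (3/5 * dist x y)\<^sup>2" by simp
qed simp

lemma harm_affine: "harm i ((1 - t) *\<^sub>R a + t *\<^sub>R b) = (1 - t) *\<^sub>R harm i a + t *\<^sub>R harm i b"
proof -
  have *: "(1 - t) *\<^sub>R a + t *\<^sub>R b - p i = (1 - t) *\<^sub>R (a - p i) + t *\<^sub>R (b - p i)"
    by (simp add: algebra_simps)
  show ?thesis
    unfolding harm_def * inner_add_left inner_scaleR_left by (simp add: vec_eq_iff field_simps)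
qed

text \<open>On each cell \<open>v\<close> is an affine function of the harmonic map
  \<open>H\<close>, so its midpoint values obey the 2/5, 2/5, 1/5 rule and the remainder in
  \<open>Q0_refine\<close> vanishes at every level. The values at \<open>p 1\<close> and
  \<open>p 2\<close> are 1/3 and -1/6.\<close>

lemma nonconstant_finite_energy:
  obtains v where "continuous_on (K_star p) v" "v (p 1) \<noteq> v (p 2)" "\<And>m. energy p m v = energy p 0 v"
proof -
  have glue: "harm i (p j) = harm j (p i)" if "i \<in> S" "j \<in> S" for i j
    using that by (simp add: harm_vertex add.commute)
  have fix_harm: "harm i (p i) = p i" if "i \<in> S" for i
    using that by (simp add: harm_vertex)
  have c: "(0::real) \<le> 0" "(0::real) < 1" "0 < (3/5 :: real)" "3/5 < (1 :: real)" by auto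
  obtain H where H: "continuous_on (K_star p) H"
    "\<And>i x. i \<in> S \<Longrightarrow> x \<in> K_star p \<Longrightarrow> H (F p i x) = harm i (H x)"
    "\<And>i. i \<in> S \<Longrightarrow> H (p i) = p i"
    by (rule gasket_semiconjugacy[where f = harm and q = p,
          OF K_star_is_gasket c dist_harm_le fix_harm glue])
       (auto simp: F_eq_G intro: that)
  define v where "v x = p 1 \<bullet> H x" for x
  have "energy p (Suc m) v = energy p m v" for m
  proof -
    have "5/3 * (\<Sum>i\<in>S. Q0 p (v \<circ> comp_word (F p) w \<circ> F p i) (v \<circ> comp_word (F p) w \<circ> F p i))
        = Q0 p (v \<circ> comp_word (F p) w) (v \<circ> comp_word (F p) w)" if w: "w \<in> W m" for w
    proof -
      have wS: "set w \<subseteq> S" using w by (simp add: W_def)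
      define l where "l y = p 1 \<bullet> comp_word harm w y" for y
      have vl: "(v \<circ> comp_word (F p) w) x = l (H x)" if "x \<in> K_star p" for x
        using comp_word_semiconj[where g = H and h = harm, OF wS F_K_star H(2) that]
        by (simp add: v_def l_def)
      have l_affine: "l ((1 - t) *\<^sub>R a + t *\<^sub>R b) = (1 - t) * l a + t * l b" for t a b
        using comp_word_affine[of harm t, OF harm_affine]
        by (simp add: l_def inner_add_right)
      \<comment> \<open>Affinity is available for two points at a time, so the three-point average
        is taken as the midpoint of \<open>a\<close> and \<open>b\<close> followed by a point on the
        way to \<open>c\<close>.\<close>
      have l3: "l ((2/5) *\<^sub>R a + (2/5) *\<^sub>R b + (1/5) *\<^sub>R c) = (2 * l a + 2 * l b + l c) / 5" for a b c
      proof -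
        have "(2/5) *\<^sub>R a + (2/5) *\<^sub>R b + (1/5) *\<^sub>R c
            = (1 - 1/5) *\<^sub>R ((1 - 1/2) *\<^sub>R a + (1/2) *\<^sub>R b) + (1/5) *\<^sub>R c"
          by (simp add: algebra_simps)
        then show ?thesis using l_affine[of "1/5"] l_affine[of "1/2" a b] by simp
      qed
      have vertex: "(v \<circ> comp_word (F p) w) (p i) = l (p i)" if "i \<in> S" for i
        using vl[OF p_in_K_star[OF that]] H(3)[OF that] by simp
      have mid: "(v \<circ> comp_word (F p) w) (F p i (p j)) = (2 * l (p i) + 2 * l (p j) + l (p k)) / 5"
        if "i \<in> S" "j \<in> S" "i \<noteq> j" "p i + p j + p k = 0" for i j k
      proof -
        have "F p i (p j) \<in> K_star p" using F_K_star p_in_K_star that by blast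
        then have "(v \<circ> comp_word (F p) w) (F p i (p j)) = l (harm i (p j))"
          using vl H(2,3) p_in_K_star that by simp
        also have "harm i (p j) = (2/5) *\<^sub>R p i + (2/5) *\<^sub>R p j + (1/5) *\<^sub>R p k"
        proof -
          have pk: "p k = - (p i + p j)" using that(4) by (simp only: add_eq_0_iff)
          show ?thesis using that(1-3) unfolding pk by (simp add: harm_vertex vec_eq_iff field_simps)
        qed
        finally show ?thesis unfolding l3 .
      qed
      have S3: "1 \<in> S" "2 \<in> S" "3 \<in> S" by (simp_all add: S_def)
      have perm: "p 2 + p 3 + p 1 = 0" "p 3 + p 1 + p 2 = 0"
        using sum_p by (simp_all only: add_ac)
      have ne: "(1 :: nat) \<noteq> 2" "(2 :: nat) \<noteq> 3" "(3 :: nat) \<noteq> 1" by auto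
      show ?thesis
        unfolding Q0_refine vertex[OF S3(1)] vertex[OF S3(2)] vertex[OF S3(3)]
          mid[OF S3(1,2) ne(1) sum_p] mid[OF S3(2,3) ne(2) perm(1)] mid[OF S3(3,1) ne(3) perm(2)]
        by simp
    qed
    then show ?thesis unfolding energy_Suc unfolding energy_def by simp
  qed
  then have "energy p m v = energy p 0 v" for m by (induction m) auto
  moreover have "continuous_on (K_star p) v"
    unfolding v_def by (intro continuous_intros H(1))
  moreover have "v (p 1) \<noteq> v (p 2)"
    using H(3) inner_p[of 1 1] inner_p[of 1 2] by (simp add: v_def S_def)
  ultimately show thesis by (rule that[rotated 2])
qed

end


section \<open>Resistance forms of projected functions\<close>

lemma MP_seqD:
  assumes "R \<in> MP_seq" "1 \<le> m"
  shows "0 < snd (R m)" "snd (R m) < 1" "fst (R m) = 3/5 * (1 - snd (R m))"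
proof -
  have "R m \<in> MP" using assms by (simp add: MP_seq_def)
  then have "0 < fst (R m)" "0 < snd (R m)" "5/3 * fst (R m) + snd (R m) = 1"
    by (auto simp: MP_def split: prod.splits)
  then show "0 < snd (R m)" "snd (R m) < 1" "fst (R m) = 3/5 * (1 - snd (R m))" by auto
qed

text \<open>This is \<open>delta\<close> freed of its factor (3/5)^m; the reciprocals are the
  partial products of \<open>C_star\<close>.\<close>

definition deficit :: "(nat \<Rightarrow> real \<times> real) \<Rightarrow> nat \<Rightarrow> real" where
  "deficit R m = (\<Prod>k=1..m. 1 - snd (R k))"

lemma deficit_pos: "R \<in> MP_seq \<Longrightarrow> 0 < deficit R m"
  unfolding deficit_def by (intro prod_pos) (auto simp: MP_seqD)

lemma delta_eq: "R \<in> MP_seq \<Longrightarrow> delta R m = (3/5)^m * deficit R m"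
proof -
  assume R: "R \<in> MP_seq"
  have "delta R m = (\<Prod>k=1..m. 3/5 * (1 - snd (R k)))"
    unfolding delta_def by (rule prod.cong) (auto simp: MP_seqD(3)[OF R])
  also have "\<dots> = (3/5)^m * deficit R m"
    unfolding prod.distrib deficit_def by simp
  finally show ?thesis .
qed

text \<open>Each factor satisfies \<open>inverse (1 - r) \<ge> 1 + r\<close>, and expanding the
  product of the \<open>1 + r\<close> leaves at least 1 plus the sum. Thus a divergent series makes
  the reciprocals unbounded.\<close>

lemma sum_le_inverse_deficit:
  assumes R: "R \<in> MP_seq"
  shows "1 + (\<Sum>k<m. snd (R (Suc k))) \<le> inverse (deficit R m)"
proof (induction m)
  case 0
  then show ?case by (simp add: deficit_def)
next
  case (Suc m)
  define r where "r = snd (R (Suc m))"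
  have r: "0 < r" "r < 1" using MP_seqD[OF R, of "Suc m"] by (auto simp: r_def)
  have nonneg: "0 \<le> (\<Sum>k<m. snd (R (Suc k)))"
    using MP_seqD(1)[OF R] by (intro sum_nonneg) (simp add: less_imp_le)
  have "1 + r \<le> inverse (1 - r)"
    using r by (simp add: field_simps)
  have "1 + (\<Sum>k<Suc m. snd (R (Suc k))) \<le> (1 + (\<Sum>k<m. snd (R (Suc k)))) * (1 + r)"
    using nonneg r by (simp add: algebra_simps r_def)
  also have "\<dots> \<le> inverse (deficit R m) * inverse (1 - r)"
    using Suc nonneg r \<open>1 + r \<le> inverse (1 - r)\<close> deficit_pos[OF R, of m]
    by (intro mult_mono) auto
  also have "\<dots> = inverse (deficit R (Suc m))"
    by (simp add: deficit_def r_def)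
  finally show ?case .
qed

text \<open>Summability of the \<rho> is absolute convergence of the product of the 1 - \<rho>;
  convergence in the sense of infinite products excludes a zero limit and so passes to the
  inverses.\<close>

lemma inverse_deficit_LIMSEQ:
  assumes R: "R \<in> MP_seq" and sum: "summable (\<lambda>m. snd (R (Suc m)))"
  shows "(\<lambda>m. inverse (deficit R m)) \<longlonglongrightarrow> C_star R"
proof -
  have "abs_convergent_prod (\<lambda>m. 1 - snd (R (Suc m)))"
    unfolding abs_convergent_prod_conv_summable using sum MP_seqD(1)[OF R]
    by (simp add: less_imp_le abs_of_nonneg)
  then have "convergent_prod (\<lambda>m. inverse (1 - snd (R (Suc m))))"
    by (intro convergent_prod_inverse abs_convergent_prod_imp_convergent_prod)
  from convergent_prod_LIMSEQ[OF this]
  have "(\<lambda>n. \<Prod>i\<le>n. inverse (1 - snd (R (Suc i)))) \<longlonglongrightarrow> C_star R"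
    by (simp add: C_star_def)
  \<comment> \<open>The product over \<open>i \<le> n\<close> has n + 1 factors, hence the shifted
    index.\<close>
  moreover have "(\<Prod>i\<le>n. inverse (1 - snd (R (Suc i)))) = inverse (deficit R (Suc n))" for n
    by (induction n) (simp_all add: deficit_def)
  ultimately have "(\<lambda>n. inverse (deficit R (Suc n))) \<longlonglongrightarrow> C_star R" by simp
  then show ?thesis by (rule LIMSEQ_imp_Suc)
qed

text \<open>Links divergence as a value in the extended reals to failure of real summability, on
  which the estimates operate.\<close>

lemma suminf_ereal_eq_infinity_iff:
  fixes f :: "nat \<Rightarrow> real"
  assumes "\<And>n. 0 \<le> f n"
  shows "(\<Sum>n. ereal (f n)) = \<infinity> \<longleftrightarrow> \<not> summable f"
proof
  show "\<not> summable f" if "(\<Sum>n. ereal (f n)) = \<infinity>"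
    using that suminf_ereal'[of f] by auto
  show "(\<Sum>n. ereal (f n)) = \<infinity>" if "\<not> summable f"
    using that summable_ereal[of f] assms by auto
qed

section \<open>Functions factoring through the projection\<close>

context stretched
begin

text \<open>\<open>pi_star\<close> collapses each edge to a point, so \<open>u\<close> is constant
  there and its segment energy is 0. It also sends the vertices of a cell of \<open>K\<close> to
  those of the cell of \<open>K_star\<close> with the same word, so the discrete energies
  agree.\<close>

lemma embed_K_forms:
  assumes v: "v \<in> C_K_star p" and u: "\<And>x. x \<in> K p \<alpha> \<Longrightarrow> u x = v (pi_star p \<alpha> x)"
  shows "u \<in> F_tilde p \<alpha>" and "D_I p \<alpha> m u u = 0"
    and "(5/3)^m * Q_Sigma p \<alpha> m u u = energy p m v"
proof -
  have edge: "u x = v (comp_word (F p) w (F p i (p j)))"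
    if "w \<in> W_star" "(i, j) \<in> B" "x \<in> closed_segment (edge_end p \<alpha> w i j) (edge_end p \<alpha> w j i)" for w i j x
  proof -
    have w: "set w \<subseteq> S" using that(1) by (auto simp: W_star_def W_def)
    have x: "x \<in> edge p \<alpha> w i j" using that(3) by (simp add: closed_segment_edge_end)
    show ?thesis
      using u edge_subset_K[OF w that(2)] x pi_star_edge[OF w that(2) x] by auto
  qed
  have seg: "u \<in> H1_seg (edge_end p \<alpha> w i j) (edge_end p \<alpha> w j i)"
    "D_seg (edge_end p \<alpha> w i j) (edge_end p \<alpha> w j i) u u = 0"
    if "w \<in> W_star" "(i, j) \<in> B" for w i j
    by (rule const_on_segment[where u = u, OF edge[OF that]], assumption)+
  have "continuous_on (K p \<alpha>) (\<lambda>x. v (pi_star p \<alpha> x))"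
    by (rule continuous_on_compose2[OF _ pi_star_cont]) (use v pi_star_K in \<open>auto simp: C_K_star_def\<close>)
  then have "continuous_on (K p \<alpha>) u"
    by (rule continuous_on_eq) (simp add: u)
  then show "u \<in> F_tilde p \<alpha>"
    unfolding F_tilde_def C_K_def using seg(1) by fastforce
  show "D_I p \<alpha> m u u = 0"
    unfolding D_I_def using seg(2) by (intro sum.neutral) (auto simp: W_star_def)
  have "Q0 p (u \<circ> comp_word (G p \<alpha>) w) (u \<circ> comp_word (G p \<alpha>) w)
      = Q0 p (v \<circ> comp_word (F p) w) (v \<circ> comp_word (F p) w)" if "w \<in> W m" for w
  proof -
    have w: "set w \<subseteq> S" using that by (simp add: W_def)
    have "u (comp_word (G p \<alpha>) w (p i)) = v (comp_word (F p) w (p i))" if "i \<in> S" for i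
      using u[OF comp_word_in_K[OF w p_in_K[OF that]]] pi_star_comp_word[OF w p_in_K[OF that]]
        pi_star_p[OF that] by simp
    from this[of 1] this[of 2] this[of 3] show ?thesis by (simp add: Q0_eq S_def)
  qed
  then show "(5/3)^m * Q_Sigma p \<alpha> m u u = energy p m v"
    unfolding Q_Sigma_def energy_def by simp
qed

lemma embed_K_E_Rm:
  assumes R: "R \<in> MP_seq" and v: "v \<in> C_K_star p"
    and u: "\<And>x. x \<in> K p \<alpha> \<Longrightarrow> u x = v (pi_star p \<alpha> x)"
  shows "E_Rm p \<alpha> R m u u = energy p m v * inverse (deficit R m)"
proof -
  note forms = embed_K_forms[OF v u]
  have "E_Rm p \<alpha> R m u u = 1 / delta R m * Q_Sigma p \<alpha> m u u"
    unfolding E_Rm_def by (simp add: forms(2))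
  also have "\<dots> = (5/3)^m * Q_Sigma p \<alpha> m u u * inverse (deficit R m)"
    by (simp add: delta_eq[OF R] power_divide field_simps)
  finally show ?thesis by (simp add: forms(3))
qed

lemma constant_in_F_R_star:
  assumes R: "R \<in> MP_seq" and u: "\<And>x. x \<in> K p \<alpha> \<Longrightarrow> u x = c"
  shows "u \<in> F_R_star p \<alpha> R"
proof -
  have v: "(\<lambda>_. c) \<in> C_K_star p" by (simp add: C_K_star_def)
  have "energy p m (\<lambda>_. c) = 0" for m by (simp add: energy_def Q0_eq)
  then have "E_Rm p \<alpha> R m u u = 0" for m
    using embed_K_E_Rm[OF R v] u by simp
  then have "u \<in> F_R p \<alpha> R"
    using embed_K_forms(1)[OF v] u by (simp add: F_R_def convergent_const)
  moreover have "u \<in> embed_K p \<alpha> (C_K_star p)"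
    using u v by (auto simp: embed_K_def intro!: bexI[of _ "\<lambda>_. c"])
  ultimately show ?thesis by (simp add: F_R_star_def)
qed

lemma F_R_star_constant:
  assumes R: "R \<in> MP_seq" and div: "\<not> summable (\<lambda>m. snd (R (Suc m)))" and u: "u \<in> F_R_star p \<alpha> R"
  shows "\<exists>c. \<forall>x\<in>K p \<alpha>. u x = c"
proof -
  obtain v where v: "v \<in> C_K_star p" and uv: "\<And>x. x \<in> K p \<alpha> \<Longrightarrow> u x = v (pi_star p \<alpha> x)"
    using u by (auto simp: F_R_star_def embed_K_def)
  have E_Rm: "E_Rm p \<alpha> R m u u = energy p m v * inverse (deficit R m)" for m
    by (rule embed_K_E_Rm[OF R v uv])
  have "convergent (\<lambda>m. E_Rm p \<alpha> R m u u)"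
    using u by (simp add: F_R_star_def F_R_def)
  from convergent_imp_Bseq[OF this] obtain b where "\<And>m. \<bar>E_Rm p \<alpha> R m u u\<bar> \<le> b"
    unfolding Bseq_def real_norm_def by blast
  then have b: "energy p m v * inverse (deficit R m) \<le> b" for m
    unfolding E_Rm[symmetric] by (rule abs_le_D1)
  have pos: "0 \<le> snd (R (Suc k))" for k using MP_seqD(1)[OF R, of "Suc k"] by simp
  have zero: "energy p n v = 0" for n
  proof (rule ccontr)
    assume "energy p n v \<noteq> 0"
    then have en: "0 < energy p n v" using energy_nonneg[of p n v] by simp
    have "(\<Sum>k<m. snd (R (Suc k))) \<le> b / energy p n v" for m
    proof -
      \<comment> \<open>At level \<open>max m n\<close> the energy has reached that of level
        \<open>n\<close> by monotonicity, and the sum contains all terms up to \<open>m\<close>. The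
        bounded product of the two then bounds every partial sum.\<close>
      have "(\<Sum>k<m. snd (R (Suc k))) \<le> (\<Sum>k<max m n. snd (R (Suc k)))"
        using pos by (intro sum_mono2) auto
      also have "\<dots> \<le> inverse (deficit R (max m n))"
        using sum_le_inverse_deficit[OF R, of "max m n"] by simp
      finally have "energy p n v * (\<Sum>k<m. snd (R (Suc k))) \<le> energy p (max m n) v * inverse (deficit R (max m n))"
        using incseqD[OF energy_mono, of n "max m n"] en pos deficit_pos[OF R]
        by (intro mult_mono energy_nonneg sum_nonneg) auto
      also have "\<dots> \<le> b" by (rule b)
      finally show ?thesis using en by (simp add: field_simps)
    qed
    then have "summable (\<lambda>k. snd (R (Suc k)))"
      by (rule summableI_nonneg_bounded[OF pos])
    then show False using div by simp
  qed
  have "u x = v (p 1)" if "x \<in> K p \<alpha>" for x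
    using uv[OF that] energy_0_imp_const[OF _ zero pi_star_K[OF that]] v by (simp add: C_K_star_def)
  then show ?thesis by blast
qed

text \<open>Everything reduces to the increasing bounded sequence \<open>energy p m v\<close> with
  limit \<open>L\<close>: \<open>E_star\<close> is \<open>L\<close> itself, and \<open>E_R\<close>
  is \<open>L\<close> times the limit of the reciprocal deficits. As the line part is 0, the whole
  form is its SG part.\<close>

lemma embed_F_star:
  assumes R: "R \<in> MP_seq" and sum: "summable (\<lambda>m. snd (R (Suc m)))"
    and u: "u \<in> embed_K p \<alpha> (F_star p)"
  shows "u \<in> F_R_star p \<alpha> R" "E_R p \<alpha> R u u = E_R_SG p \<alpha> R u"
    "E_R_SG p \<alpha> R u = C_star R * E_star p \<alpha> u"
proof -
  obtain v where vF: "v \<in> F_star p" and uv: "\<And>x. x \<in> K p \<alpha> \<Longrightarrow> u x = v (pi_star p \<alpha> x)"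
    using u by (auto simp: embed_K_def)
  have v: "v \<in> C_K_star p" using vF by (simp add: F_star_def)
  have F_tilde: "u \<in> F_tilde p \<alpha>" and D_I: "D_I p \<alpha> m u u = 0"
    and Q: "(5/3)^m * Q_Sigma p \<alpha> m u u = energy p m v" for m
    by (rule embed_K_forms[OF v uv], assumption)+
  have "bounded (range (\<lambda>m. energy p m v))"
    using vF by (simp add: F_star_def energy_def)
  then obtain L where L: "(\<lambda>m. energy p m v) \<longlonglongrightarrow> L"
    using energy_mono Bseq_monoseq_convergent[of "\<lambda>m. energy p m v"]
    by (auto simp: Bseq_eq_bounded incseq_imp_monoseq convergent_def)
  have E_Rm: "E_Rm p \<alpha> R m u u = energy p m v * inverse (deficit R m)" for m
    by (rule embed_K_E_Rm[OF R v uv])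
  have "(\<lambda>m. E_Rm p \<alpha> R m u u) \<longlonglongrightarrow> L * C_star R"
    unfolding E_Rm by (intro tendsto_mult L inverse_deficit_LIMSEQ[OF R sum])
  then have conv: "convergent (\<lambda>m. E_Rm p \<alpha> R m u u)" and lim: "E_R p \<alpha> R u u = L * C_star R"
    by (auto simp: convergent_def E_R_def limI)
  show "u \<in> F_R_star p \<alpha> R"
    using conv F_tilde v uv by (auto simp: F_R_star_def F_R_def embed_K_def)
  have "E_R_line p \<alpha> R u = 0"
    unfolding E_R_line_def by (simp add: D_I)
  then show SG: "E_R p \<alpha> R u u = E_R_SG p \<alpha> R u"
    by (simp add: E_R_SG_def)
  have "E_star p \<alpha> u = L"
    unfolding E_star_def Q by (rule limI[OF L])
  then show "E_R_SG p \<alpha> R u = C_star R * E_star p \<alpha> u"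
    using lim SG by simp
qed

text \<open>The harmonic function has the same energy at every level and so belongs to
  \<open>F_star\<close>; composed with \<open>pi_star\<close>, which fixes the vertices, it still
  separates \<open>p 1\<close> from \<open>p 2\<close>.\<close>

lemma F_R_star_nonconstant:
  assumes R: "R \<in> MP_seq" and sum: "summable (\<lambda>m. snd (R (Suc m)))"
  shows "\<exists>u\<in>F_R_star p \<alpha> R. \<not> (\<exists>c. \<forall>x\<in>K p \<alpha>. u x = c)"
proof -
  obtain v where v: "continuous_on (K_star p) v" "v (p 1) \<noteq> v (p 2)" "\<And>m. energy p m v = energy p 0 v"
    by (rule nonconstant_finite_energy) (rule that)
  have "range (\<lambda>m. energy p m v) \<subseteq> {energy p 0 v}"
    using v(3) by auto
  then have "bounded (range (\<lambda>m. energy p m v))"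
    by (rule bounded_subset[rotated]) simp
  then have "v \<in> F_star p"
    using v(1) by (simp add: F_star_def C_K_star_def energy_def)
  then have "v \<circ> pi_star p \<alpha> \<in> F_R_star p \<alpha> R"
    by (intro embed_F_star(1)[OF R sum]) (auto simp: embed_K_def)
  moreover have "p 1 \<in> K p \<alpha>" "p 2 \<in> K p \<alpha>" "(v \<circ> pi_star p \<alpha>) (p 1) \<noteq> (v \<circ> pi_star p \<alpha>) (p 2)"
    using p_in_K[of 1] p_in_K[of 2] pi_star_p[of 1] pi_star_p[of 2] v(2) by (auto simp: S_def)
  ultimately show ?thesis by metis
qed

end

theorem theorem9p4:
  fixes p :: "nat \<Rightarrow> real^2" and \<alpha> :: real and R :: "nat \<Rightarrow> real \<times> real"
  assumes "regular_triangle p"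
    and "0 < \<alpha>" and "\<alpha> < 1"
    and "R \<in> MP_seq"
  shows "(F_R_star p \<alpha> R = {u. \<exists>c. \<forall>x\<in>K p \<alpha>. u x = c} \<longleftrightarrow>
            (\<Sum>m. ereal (snd (R (Suc m)))) = \<infinity>) \<and>
         ((\<Sum>m. ereal (snd (R (Suc m)))) < \<infinity> \<longrightarrow>
            embed_K p \<alpha> (F_star p) \<subseteq> F_R_star p \<alpha> R \<and>
            (\<forall>u\<in>embed_K p \<alpha> (F_star p).
               E_R p \<alpha> R u u = E_R_SG p \<alpha> R u \<and>
               E_R_SG p \<alpha> R u = C_star R * E_star p \<alpha> u))"
proof -
  interpret stretched p \<alpha>
    by unfold_locales (use assms in auto)
  note R = assms(4)
  have pos: "0 \<le> snd (R (Suc m))" for m using MP_seqD(1)[OF R, of "Suc m"] by simp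
  note inf = suminf_ereal_eq_infinity_iff[of "\<lambda>m. snd (R (Suc m))", OF pos]
  have 1: "F_R_star p \<alpha> R = {u. \<exists>c. \<forall>x\<in>K p \<alpha>. u x = c} \<longleftrightarrow> \<not> summable (\<lambda>m. snd (R (Suc m)))"
  proof
    assume eq: "F_R_star p \<alpha> R = {u. \<exists>c. \<forall>x\<in>K p \<alpha>. u x = c}"
    show "\<not> summable (\<lambda>m. snd (R (Suc m)))"
      using F_R_star_nonconstant[OF R] unfolding eq by blast
  next
    assume div: "\<not> summable (\<lambda>m. snd (R (Suc m)))"
    show "F_R_star p \<alpha> R = {u. \<exists>c. \<forall>x\<in>K p \<alpha>. u x = c}"
    proof (intro set_eqI iffI CollectI)
      show "\<exists>c. \<forall>x\<in>K p \<alpha>. u x = c" if "u \<in> F_R_star p \<alpha> R" for u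
        by (rule F_R_star_constant[OF R div that])
      show "u \<in> F_R_star p \<alpha> R" if "u \<in> {u. \<exists>c. \<forall>x\<in>K p \<alpha>. u x = c}" for u
        using that constant_in_F_R_star[OF R] by blast
    qed
  qed
  have 2: "embed_K p \<alpha> (F_star p) \<subseteq> F_R_star p \<alpha> R \<and>
      (\<forall>u\<in>embed_K p \<alpha> (F_star p).
         E_R p \<alpha> R u u = E_R_SG p \<alpha> R u \<and> E_R_SG p \<alpha> R u = C_star R * E_star p \<alpha> u)"
    if "(\<Sum>m. ereal (snd (R (Suc m)))) < \<infinity>"
  proof -
    have "summable (\<lambda>m. snd (R (Suc m)))" using that inf by auto
    then show ?thesis using embed_F_star[OF R] by blast
  qed
  show ?thesis
    by (rule conjI[OF trans[OF 1 inf[symmetric]]], rule impI, rule 2)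
qed

end
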